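(* Let $c \geq 2$ and let $I=(F,k)$ be an instance of Max-$c$-Lin-2 Above Average that is reduced, i.e. there is no pair of equations $e,e'\in F$ with $e\equiv e'+1 \pmod 2$ (same variable set, different right-hand sides). If the number of variables appearing in $F$ is at least $(c(c+1)/2)k$, then $I$ is a yes-instance, and an assignment of weight at least $W/2+k/2$ can be found in polynomial time.
   Context: Max-$c$-Lin-2 Above Average: the input is a parameter $k\ge 0$ and a system $F$ of linear equations over $\mathbb{F}_2$, each of the form $\sum_{i\in T}x_i=b$ with $b\in\{0,1\}$ and at most $c$ variables, each equation $e$ having a positive integer weight $w(e)$. The weight of an assignment is the total weight of the equations it satisfies. $W$ denotes the total weight of all equations. The instance is a yes-instance if some assignment has weight at least $W/2+k/2$.
   Formalization: The system is assumed to contain no variable-free equation 0 = 1; with a heavy such equation the claim fails (c=2, k=1, x1=1, x2=1, x3=1 of weight 1 and 0=1 of weight 100). *)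

theory Defs
  imports
    Complex_Main
    "HOL-Library.Z2"
    "HOL-Library.Discrete_Functions"
    "HOL-Computational_Algebra.Polynomial"
begin

section \<open>Weighted linear equations over the two-element field\<close>

record wt_eqn =
  vars :: "nat set"
  rhs :: bit
  wt :: nat

type_synonym lin_system = "wt_eqn list"

definition satisfies :: "(nat \<Rightarrow> bit) \<Rightarrow> wt_eqn \<Rightarrow> bool" where
  "satisfies x e \<longleftrightarrow> (\<Sum>i\<in>vars e. x i) = rhs e"

definition assignment_weight :: "lin_system \<Rightarrow> (nat \<Rightarrow> bit) \<Rightarrow> nat" where
  "assignment_weight F x = (\<Sum>e\<leftarrow>F. if satisfies x e then wt e else 0)"

definition total_weight :: "lin_system \<Rightarrow> nat" where
  "total_weight F = (\<Sum>e\<leftarrow>F. wt e)"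

definition system_vars :: "lin_system \<Rightarrow> nat set" where
  "system_vars F = (\<Union>e\<in>set F. vars e)"

text \<open>The last conjunct excludes the degenerate equation \<open>0 = 1\<close> without variables. No assignment
  satisfies it, so a single heavy copy would turn any instance into a no-instance.\<close>

definition max_lin2_system :: "nat \<Rightarrow> lin_system \<Rightarrow> bool" where
  "max_lin2_system c F \<longleftrightarrow>
     (\<forall>e\<in>set F. finite (vars e) \<and> card (vars e) \<le> c \<and> wt e > 0 \<and>
        \<not> (vars e = {} \<and> rhs e = 1))"

definition reduced :: "lin_system \<Rightarrow> bool" where
  "reduced F \<longleftrightarrow> \<not> (\<exists>e\<in>set F. \<exists>e'\<in>set F. vars e = vars e' \<and> rhs e = rhs e' + 1)"

definition above_average :: "lin_system \<Rightarrow> nat \<Rightarrow> (nat \<Rightarrow> bit) \<Rightarrow> bool" where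
  "above_average F k x \<longleftrightarrow>
     real (assignment_weight F x) \<ge> real (total_weight F) / 2 + real k / 2"

definition yes_instance :: "lin_system \<Rightarrow> nat \<Rightarrow> bool" where
  "yes_instance F k \<longleftrightarrow> (\<exists>x. above_average F k x)"


section \<open>Polynomial time\<close>

text \<open>The machine model is a random access machine with a structured control flow. Its memory
  consists of unbounded arrays of natural numbers; a program names arrays by constants, so it uses
  only finitely many of them. Every executed command costs one unit. As the only arithmetic
  operations are addition and truncated subtraction (there is no multiplication), one step increases
  the bit length of the numbers in memory by at most a constant depending on the program, and hence
  the unit cost measure is polynomially related to Turing machine time.\<close>

type_synonym ram_state = "nat \<Rightarrow> nat \<Rightarrow> nat"

datatype aexp = Const nat | Arr nat aexp | Plus aexp aexp | Minus aexp aexp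

datatype bexp = Less aexp aexp | Not bexp | And bexp bexp

datatype com =
    Skip
  | Store nat aexp aexp
  | Seq com com
  | Cond bexp com com
  | While bexp com

fun aval :: "aexp \<Rightarrow> ram_state \<Rightarrow> nat" where
  "aval (Const n) s = n"
| "aval (Arr j a) s = s j (aval a s)"
| "aval (Plus a b) s = aval a s + aval b s"
| "aval (Minus a b) s = aval a s - aval b s"

fun bval :: "bexp \<Rightarrow> ram_state \<Rightarrow> bool" where
  "bval (Less a b) s \<longleftrightarrow> aval a s < aval b s"
| "bval (Not p) s \<longleftrightarrow> \<not> bval p s"
| "bval (And p q) s \<longleftrightarrow> bval p s \<and> bval q s"

text \<open>\<open>runs P s t s'\<close>: started in state \<open>s\<close>, program \<open>P\<close> halts in state \<open>s'\<close> after \<open>t\<close> steps.\<close>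

inductive runs :: "com \<Rightarrow> ram_state \<Rightarrow> nat \<Rightarrow> ram_state \<Rightarrow> bool" where
  Skip: "runs Skip s 1 s"
| Store: "runs (Store j a b) s 1 (s(j := (s j)(aval a s := aval b s)))"
| Seq: "runs P s t s' \<Longrightarrow> runs Q s' u s'' \<Longrightarrow> runs (Seq P Q) s (t + u + 1) s''"
| CondTrue: "bval p s \<Longrightarrow> runs P s t s' \<Longrightarrow> runs (Cond p P Q) s (t + 1) s'"
| CondFalse: "\<not> bval p s \<Longrightarrow> runs Q s t s' \<Longrightarrow> runs (Cond p P Q) s (t + 1) s'"
| WhileFalse: "\<not> bval p s \<Longrightarrow> runs (While p P) s 1 s"
| WhileTrue: "bval p s \<Longrightarrow> runs P s t s' \<Longrightarrow> runs (While p P) s' u s'' \<Longrightarrow>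
    runs (While p P) s (t + u + 1) s''"

text \<open>The input is stored in array \<open>0\<close> and the output is read off array \<open>1\<close>; in both, cell \<open>0\<close> holds
  the length of the list and cell \<open>i + 1\<close> its \<open>i\<close>-th entry.\<close>

definition input_state :: "nat list \<Rightarrow> ram_state" where
  "input_state xs j i =
     (if j \<noteq> 0 then 0
      else if i = 0 then length xs
      else if i \<le> length xs then xs ! (i - 1)
      else 0)"

definition output_list :: "ram_state \<Rightarrow> nat list" where
  "output_list s = map (\<lambda>i. s 1 (i + 1)) [0..<s 1 0]"

text \<open>The size of an input is its total number of binary digits, so that numbers such as the weights
  are charged in binary.\<close>

definition input_size :: "nat list \<Rightarrow> nat" where
  "input_size xs = (\<Sum>x\<leftarrow>xs. floor_log x + 1)"

text \<open>\<open>poly_time_search enc D R\<close>: some program, given the encoding of any \<open>a\<close> in \<open>D\<close>, produces in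
  polynomial time an output related to \<open>a\<close> by \<open>R\<close>. The length of the output is charged as well, since
  writing the length cell takes only one step.\<close>

definition poly_time_search ::
  "('a \<Rightarrow> nat list) \<Rightarrow> 'a set \<Rightarrow> ('a \<Rightarrow> nat list \<Rightarrow> bool) \<Rightarrow> bool" where
  "poly_time_search enc D R \<longleftrightarrow>
     (\<exists>(P :: com) (q :: nat poly). \<forall>a\<in>D. \<exists>t s.
        runs P (input_state (enc a)) t s \<and>
        t + length (output_list s) \<le> poly q (input_size (enc a)) \<and>
        R a (output_list s))"


section \<open>Encoding of instances and assignments\<close>

definition encode_eqn :: "wt_eqn \<Rightarrow> nat list" where
  "encode_eqn e =
     card (vars e) # sorted_list_of_set (vars e) @ [if rhs e = 1 then 1 else 0, wt e]"

fun encode_instance :: "lin_system \<times> nat \<Rightarrow> nat list" where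
  "encode_instance (F, k) = k # length F # concat (map encode_eqn F)"

text \<open>An assignment is output as the list of the variables that receive the value \<open>1\<close>.\<close>

definition decode_assignment :: "nat list \<Rightarrow> nat \<Rightarrow> bit" where
  "decode_assignment ys i = (if i \<in> set ys then 1 else 0)"

end

theory Submission
  imports Defs
begin

text \<open>For \<open>j = c, c - 1, \<dots>, 1\<close> scan the equations and pick every equation with exactly \<open>j\<close> variables not
  covered by the equations picked before. Each picked equation of level \<open>j\<close> covers \<open>j\<close> new variables
  and in the end all variables are covered, so with at least \<open>k * (1 + \<dots> + c)\<close> variables some level
  \<open>J\<close> has at least \<open>k\<close> equations. If \<open>A\<close> is the set covered before level \<open>J\<close>, then the equations of level
  \<open>J\<close> have pairwise disjoint blocks of \<open>J\<close> variables outside \<open>A\<close>, while no equation has more than \<open>J\<close>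
  variables outside \<open>A\<close>. Solve each of them for a pivot variable in its block. By the block
  structure an equation whose value thereby becomes constant is empty or has the variable set of a
  selected equation, and since the system is reduced it is satisfied. All other equations depend on
  some free variable; fixing the free variables one after the other, each so that at least half of the
  weight whose last free variable it is gets satisfied, yields twice the weight at least \<open>W + k\<close>.\<close>

text \<open>Gaussian elimination on the machine is avoided by two observations. Selected equations
  may overlap inside \<open>A\<close>, but pivots lie outside \<open>A\<close>, where the blocks are
  disjoint. So no pivot occurs in another selected equation, and solving for all pivots is a single
  substitution without back substitution. After it every equation is an affine function of the free
  variables, and over the two-element field a coefficient is read off by flipping the variable and
  comparing two evaluations, at any assignment whatsoever. The program therefore stores assignments
  only, never transformed equations. The gain \<open>k\<close> arises because the selected equations
  are satisfied with certainty and have positive integer weights: twice the satisfied weight counts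
  each selected weight twice, the total weight only once, while the equations decided by majority at
  least break even. The number \<open>c\<close> is a constant of the program. One bound
  \<open>L\<close>, at least \<open>c\<close> and at least the input length, limits every loop, be
  it over cells, equations, variables of an equation or levels.\<close>

section \<open>Weakest preconditions with an iteration bound\<close>

text \<open>In \<open>wp L\<close> every execution of a loop makes at most \<open>L\<close> iterations. The running time is then bounded
  by \<open>cost L\<close>, a polynomial in \<open>L\<close> that is read off the program text.\<close>

primrec wp :: "nat \<Rightarrow> com \<Rightarrow> (ram_state \<Rightarrow> bool) \<Rightarrow> ram_state \<Rightarrow> bool" where
  "wp L Skip = (\<lambda>Q. Q)"
| "wp L (Store j a b) = (\<lambda>Q s. Q (s(j := (s j)(aval a s := aval b s))))"
| "wp L (Seq P P') = (\<lambda>Q. wp L P (wp L P' Q))"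
| "wp L (Cond p P P') = (\<lambda>Q s. if bval p s then wp L P Q s else wp L P' Q s)"
| "wp L (While p P) = (\<lambda>Q. ((\<lambda>R s. if bval p s then wp L P R s else Q s) ^^ L) (\<lambda>s. \<not> bval p s \<and> Q s))"

text \<open>Both branches of a conditional are added, instead of taking their maximum, so that the
  bound is a polynomial in \<open>L\<close>.\<close>

primrec cost :: "nat \<Rightarrow> com \<Rightarrow> nat" where
  "cost L Skip = 1"
| "cost L (Store j a b) = 1"
| "cost L (Seq P P') = cost L P + cost L P' + 1"
| "cost L (Cond p P P') = cost L P + cost L P' + 1"
| "cost L (While p P) = L * (cost L P + 1) + 1"

primrec writes :: "com \<Rightarrow> nat set" where
  "writes Skip = {}"
| "writes (Store j a b) = {j}"
| "writes (Seq P P') = writes P \<union> writes P'"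
| "writes (Cond p P P') = writes P \<union> writes P'"
| "writes (While p P) = writes P"

text \<open>Each unrolling of a loop is charged the body plus one step, and the final failing test
  one more step. The loop case is an inner induction on the number of unrollings.\<close>

lemma wp_sound: "wp L P Q s \<Longrightarrow> \<exists>t s'. runs P s t s' \<and> t \<le> cost L P \<and> Q s'"
proof (induction P arbitrary: Q s)
  case Skip
  then show ?case using runs.Skip by force
next
  case (Store j a b)
  then show ?case using runs.Store by force
next
  case (Seq P P')
  from Seq.prems obtain t s' where 1: "runs P s t s'" "t \<le> cost L P" "wp L P' Q s'"
    using Seq.IH(1) by force
  then obtain u s'' where "runs P' s' u s''" "u \<le> cost L P'" "Q s''"
    using Seq.IH(2) by blast
  with 1 show ?case using runs.Seq[of P s t s' P' u s''] by (intro exI[of _ "t + u + 1"] exI) auto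
next
  case (Cond p P P')
  show ?case
  proof (cases "bval p s")
    case True
    with Cond.prems Cond.IH(1)[of Q s] obtain t s' where "runs P s t s'" "t \<le> cost L P" "Q s'"
      by auto
    with True runs.CondTrue[of p s P t s' P'] show ?thesis by (intro exI[of _ "t + 1"] exI) auto
  next
    case False
    with Cond.prems Cond.IH(2)[of Q s] obtain t s' where "runs P' s t s'" "t \<le> cost L P'" "Q s'"
      by auto
    with False runs.CondFalse[of p s P' t s' P] show ?thesis by (intro exI[of _ "t + 1"] exI) auto
  qed
next
  case (While p P)
  define G where "G = (\<lambda>R s. if bval p s then wp L P R s else Q s)"
  have "\<exists>t s'. runs (While p P) s t s' \<and> t \<le> n * (cost L P + 1) + 1 \<and> Q s'"
    if "(G ^^ n) (\<lambda>s. \<not> bval p s \<and> Q s) s" for n s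
    using that
  proof (induction n arbitrary: s)
    case 0
    then show ?case using runs.WhileFalse by force
  next
    case (Suc n)
    show ?case
    proof (cases "bval p s")
      case True
      with Suc.prems have "wp L P ((G ^^ n) (\<lambda>s. \<not> bval p s \<and> Q s)) s"
        by (simp add: G_def)
      then obtain t s' where 1: "runs P s t s'" "t \<le> cost L P"
        and 2: "(G ^^ n) (\<lambda>s. \<not> bval p s \<and> Q s) s'"
        using While.IH by blast
      from Suc.IH[OF 2] obtain u s'' where
        "runs (While p P) s' u s''" "u \<le> n * (cost L P + 1) + 1" "Q s''"
        by blast
      with True 1 runs.WhileTrue[of p s P t s' u s''] show ?thesis
        by (intro exI[of _ "t + u + 1"] exI) auto
    next
      case False
      with Suc.prems runs.WhileFalse[of p s P] show ?thesis
        by (force simp: G_def)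
    qed
  qed
  with While.prems show ?case by (simp add: G_def)
qed

lemma wp_mono: "wp L P Q s \<Longrightarrow> (\<And>s'. Q s' \<Longrightarrow> Q' s') \<Longrightarrow> wp L P Q' s"
proof (induction P arbitrary: Q Q' s)
  case (Seq P P')
  from Seq.prems(1) have "wp L P (wp L P' Q) s" by simp
  then have "wp L P (wp L P' Q') s"
    by (rule Seq.IH(1)) (rule Seq.IH(2)[OF _ Seq.prems(2)])
  then show ?case by simp
next
  case (While p P)
  define G where "G = (\<lambda>Q R s. if bval p s then wp L P R s else Q s)"
  have "(G Q ^^ n) (\<lambda>s. \<not> bval p s \<and> Q s) s \<Longrightarrow> (G Q' ^^ n) (\<lambda>s. \<not> bval p s \<and> Q' s) s" for n s
  proof (induction n arbitrary: s)
    case 0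
    then show ?case by (simp add: While.prems(2))
  next
    case (Suc n)
    show ?case
    proof (cases "bval p s")
      case True
      with Suc.prems have "wp L P ((G Q ^^ n) (\<lambda>s. \<not> bval p s \<and> Q s)) s" by (simp add: G_def)
      then have "wp L P ((G Q' ^^ n) (\<lambda>s. \<not> bval p s \<and> Q' s)) s"
        by (rule While.IH) (rule Suc.IH)
      with True show ?thesis by (simp add: G_def)
    next
      case False
      with Suc.prems show ?thesis by (simp add: G_def While.prems(2))
    qed
  qed
  with While.prems(1) show ?case by (simp add: G_def)
qed (auto split: if_splits)

text \<open>The loop rule gets its frame conditions from here, so that invariants need to mention
  only the arrays that the body writes.\<close>

lemma wp_frame: "wp L P Q s \<Longrightarrow> wp L P (\<lambda>s'. Q s' \<and> (\<forall>j. j \<notin> writes P \<longrightarrow> s' j = s j)) s"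
proof (induction P arbitrary: Q s)
  case (Seq P P')
  from Seq.prems have "wp L P (wp L P' Q) s" by simp
  from Seq.IH(1)[OF this]
  have "wp L P (wp L P' (\<lambda>s'. Q s' \<and> (\<forall>j. j \<notin> writes (Seq P P') \<longrightarrow> s' j = s j))) s"
  proof (rule wp_mono, elim conjE)
    fix s' assume "wp L P' Q s'" and fr: "\<forall>j. j \<notin> writes P \<longrightarrow> s' j = s j"
    from Seq.IH(2)[OF this(1)]
    show "wp L P' (\<lambda>s'. Q s' \<and> (\<forall>j. j \<notin> writes (Seq P P') \<longrightarrow> s' j = s j)) s'"
      by (rule wp_mono) (simp add: fr)
  qed
  then show ?case by simp
next
  case (Cond p P P')
  show ?case
  proof (cases "bval p s")
    case True
    with Cond.prems have "wp L P Q s" by simp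
    from wp_mono[OF Cond.IH(1)[OF this]] True show ?thesis by simp
  next
    case False
    with Cond.prems have "wp L P' Q s" by simp
    from wp_mono[OF Cond.IH(2)[OF this]] False show ?thesis by simp
  qed
next
  case (While p P)
  define G where "G = (\<lambda>Q R s. if bval p s then wp L P R s else Q s)"
  define Q' where "Q' = (\<lambda>s s'. Q s' \<and> (\<forall>j. j \<notin> writes P \<longrightarrow> s' j = s j))"
  \<comment> \<open>The current state changes with each unrolling, so the frame is measured against
    a fixed reference state \<open>s0\<close>.\<close>
  have "(G Q ^^ n) (\<lambda>s. \<not> bval p s \<and> Q s) s \<Longrightarrow>
    (G (Q' s0) ^^ n) (\<lambda>s. \<not> bval p s \<and> Q' s0 s) s"
    if "\<forall>j. j \<notin> writes P \<longrightarrow> s j = s0 j" for n s s0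
    using that
  proof (induction n arbitrary: s)
    case 0
    then show ?case by (auto simp: Q'_def)
  next
    case (Suc n)
    show ?case
    proof (cases "bval p s")
      case True
      with Suc.prems have "wp L P ((G Q ^^ n) (\<lambda>s. \<not> bval p s \<and> Q s)) s"
        by (simp add: G_def)
      from While.IH[OF this] have "wp L P ((G (Q' s0) ^^ n) (\<lambda>s. \<not> bval p s \<and> Q' s0 s)) s"
        by (rule wp_mono) (use Suc in auto)
      with True show ?thesis by (simp add: G_def)
    next
      case False
      with Suc.prems show ?thesis by (simp add: G_def Q'_def)
    qed
  qed
  with While.prems show ?case by (simp add: G_def Q'_def)
qed auto

lemma cost_poly: "\<exists>q. \<forall>L. cost L P = poly q L"
proof (induction P)
  case Skip
  show ?case by (intro exI[of _ 1]) simp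
next
  case (Store j a b)
  show ?case by (intro exI[of _ 1]) simp
next
  case (Seq P P')
  then obtain p q where "\<forall>L. cost L P = poly p L" "\<forall>L. cost L P' = poly q L" by blast
  then show ?case by (intro exI[of _ "p + q + 1"]) simp
next
  case (Cond b P P')
  then obtain p q where "\<forall>L. cost L P = poly p L" "\<forall>L. cost L P' = poly q L" by blast
  then show ?case by (intro exI[of _ "p + q + 1"]) simp
next
  case (While b P)
  then obtain p where "\<forall>L. cost L P = poly p L" by blast
  then show ?case by (intro exI[of _ "[:0, 1:] * (p + 1) + 1"]) simp
qed

abbreviation Var :: "nat \<Rightarrow> aexp" where
  "Var i \<equiv> Arr i (Const 0)"

abbreviation Set :: "nat \<Rightarrow> aexp \<Rightarrow> com" where
  "Set i a \<equiv> Store i (Const 0) a"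

text \<open>The upper bound \<open>b\<close> is evaluated again before every iteration; the loop
  rule therefore asks that its value survive the body.\<close>

definition For :: "nat \<Rightarrow> aexp \<Rightarrow> aexp \<Rightarrow> com \<Rightarrow> com" where
  "For i a b P = Seq (Set i a) (While (Less (Var i) b) (Seq P (Set i (Plus (Var i) (Const 1)))))"

lemma writes_For [simp]: "writes (For i a b P) = insert i (writes P)"
  by (auto simp: For_def)

text \<open>The counter is exposed to the invariant as the number \<open>n\<close>, and
  \<open>cong\<close> makes the invariant blind to the array holding the counter, so incrementing it
  preserves the invariant. The assumption \<open>hi \<le> lo + L\<close> provides enough unrollings;
  the induction runs over the iterations still allowed.\<close>

lemma wp_For:
  assumes lo: "aval a s = lo" "lo \<le> hi" "hi \<le> lo + L"
    and i: "i \<notin> writes P"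
    and b: "\<And>s'. \<forall>j. j \<notin> insert i (writes P) \<longrightarrow> s' j = s j \<Longrightarrow> aval b s' = hi"
    and cong: "\<And>n s' f. I n s' \<Longrightarrow> I n (s'(i := f))"
    and init: "I lo s"
    and step: "\<And>n s'. lo \<le> n \<Longrightarrow> n < hi \<Longrightarrow> \<forall>j. j \<notin> insert i (writes P) \<longrightarrow> s' j = s j \<Longrightarrow>
      s' i 0 = n \<Longrightarrow> I n s' \<Longrightarrow> wp L P (I (Suc n)) s'"
    and post: "\<And>s'. \<forall>j. j \<notin> insert i (writes P) \<longrightarrow> s' j = s j \<Longrightarrow> I hi s' \<Longrightarrow> Q s'"
  shows "wp L (For i a b P) Q s"
proof -
  define P' where "P' = Seq P (Set i (Plus (Var i) (Const 1)))"
  define G where "G = (\<lambda>R s. if bval (Less (Var i) b) s then wp L P' R s else Q s)"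
  have "(G ^^ n) (\<lambda>s. \<not> bval (Less (Var i) b) s \<and> Q s) s'"
    if "hi \<le> s' i 0 + n" "lo \<le> s' i 0" "s' i 0 \<le> hi" "I (s' i 0) s'"
      "\<forall>j. j \<notin> insert i (writes P) \<longrightarrow> s' j = s j" for n s'
    using that
  proof (induction n arbitrary: s')
    case 0
    then show ?case using b[of s'] post[of s'] by auto
  next
    case (Suc n)
    show ?case
    proof (cases "s' i 0 < hi")
      case True
      from Suc.prems True have "wp L P (I (Suc (s' i 0))) s'" by (intro step) auto
      from wp_frame[OF this] have "wp L P' ((G ^^ n) (\<lambda>s. \<not> bval (Less (Var i) b) s \<and> Q s)) s'"
        unfolding P'_def wp.simps
      proof (rule wp_mono, elim conjE)
        fix s'' assume "I (Suc (s' i 0)) s''" and fr: "\<forall>j. j \<notin> writes P \<longrightarrow> s'' j = s' j"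
        moreover from this(1) have "I (Suc (s' i 0)) (s''(i := (s' i)(0 := Suc (s' i 0))))"
          by (rule cong)
        moreover from fr i have "s'' i = s' i" by auto
        ultimately show "(G ^^ n) (\<lambda>s. \<not> bval (Less (Var i) b) s \<and> Q s) (s''(i := (s'' i)
          (aval (Const 0) s'' := aval (Plus (Var i) (Const 1)) s'')))"
          using Suc.prems True by (intro Suc.IH) (simp_all add: fun_upd_def)
      qed
      with True show ?thesis using b[OF Suc.prems(5)] by (simp add: G_def)
    next
      case False
      with Suc.prems show ?thesis using b[of s'] post[of s'] by (auto simp: G_def)
    qed
  qed
  from this[of "s(i := (s i)(0 := lo))" L] lo
  have "(G ^^ L) (\<lambda>s. \<not> bval (Less (Var i) b) s \<and> Q s) (s(i := (s i)(0 := lo)))"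
    by (simp add: init cong)
  then show ?thesis unfolding For_def P'_def[symmetric] G_def by (simp only: wp.simps aval.simps lo)
qed

section \<open>Systems solved for disjoint blocks of variables\<close>

declare add_bit_eq_xor [simp del] mult_bit_eq_and [simp del]

lemma bit_cases_01: "(b :: bit) = 0 \<or> b = 1"
  by (cases b) auto

lemma bit_add_self [simp]: "x + x = (0 :: bit)"
  by (cases x) auto

lemma bit_add_left_self [simp]: "x + (x + y) = (y :: bit)"
  by (simp flip: add.assoc)

lemma bit_add_eq_0_iff: "x + y = 0 \<longleftrightarrow> x = (y :: bit)"
  by (cases x; cases y) auto

text \<open>What one level of the greedy selection yields, freed from the encoding: \<open>S\<close>
  are the equations of the level, \<open>A\<close> is the set covered before it, and the blocks are
  the sets \<open>V e - A\<close>. Reducedness of the system enters as \<open>consistent\<close>,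
  the exclusion of \<open>0 = 1\<close> as \<open>empty_rhs\<close>.\<close>

locale pivot_system =
  fixes m :: nat and V :: "nat \<Rightarrow> nat set" and b :: "nat \<Rightarrow> bit"
    and S :: "nat set" and piv :: "nat \<Rightarrow> nat" and A :: "nat set" and J :: nat
  assumes fin: "f < m \<Longrightarrow> finite (V f)"
    and S_sub: "S \<subseteq> {..<m}"
    and J_pos: "0 < J"
    and card_le: "f < m \<Longrightarrow> card (V f - A) \<le> J"
    and card_eq: "e \<in> S \<Longrightarrow> card (V e - A) = J"
    and disj: "e \<in> S \<Longrightarrow> e' \<in> S \<Longrightarrow> e \<noteq> e' \<Longrightarrow> (V e - A) \<inter> (V e' - A) = {}"
    and piv: "e \<in> S \<Longrightarrow> piv e \<in> V e - A"
    and consistent: "f < m \<Longrightarrow> g < m \<Longrightarrow> V f = V g \<Longrightarrow> b f = b g"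
    and empty_rhs: "f < m \<Longrightarrow> V f = {} \<Longrightarrow> b f = 0"
begin

text \<open>A pivot lies outside \<open>A\<close>, so belonging to two selected equations would put
  it into two disjoint blocks.\<close>

lemma piv_unique: "e \<in> S \<Longrightarrow> e' \<in> S \<Longrightarrow> piv e \<in> V e' \<Longrightarrow> e = e'"
  using disj piv by fastforce

lemma inj_piv: "inj_on piv S"
  by (rule inj_onI) (metis DiffD1 piv piv_unique)

text \<open>Solves all selected equations for their pivots at once. By \<open>piv_unique\<close> the
  variables on the right are all free, so the old values of \<open>X\<close> at pivots are
  ignored.\<close>

definition ext :: "(nat \<Rightarrow> bit) \<Rightarrow> nat \<Rightarrow> bit" where
  "ext X u = (if u \<in> piv ` S
     then b (the_inv_into S piv u) + (\<Sum>v\<in>V (the_inv_into S piv u) - {u}. X v) else X u)"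

lemma ext_piv: "e \<in> S \<Longrightarrow> ext X (piv e) = b e + (\<Sum>v\<in>V e - {piv e}. X v)"
  by (simp add: ext_def the_inv_into_f_f[OF inj_piv])

lemma ext_other: "u \<notin> piv ` S \<Longrightarrow> ext X u = X u"
  by (simp add: ext_def)

lemma ext_cong:
  assumes "\<And>v. v \<notin> piv ` S \<Longrightarrow> X v = Y v"
  shows "ext X = ext Y"
proof
  fix u show "ext X u = ext Y u"
  proof (cases "u \<in> piv ` S")
    case True
    then obtain e where e: "e \<in> S" "u = piv e" by blast
    with assms have "(\<Sum>v\<in>V e - {piv e}. X v) = (\<Sum>v\<in>V e - {piv e}. Y v)"
      by (intro sum.cong refl assms) (auto dest: piv_unique)
    with e show ?thesis by (simp add: ext_piv)
  qed (simp add: ext_other assms)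
qed

lemma ext_ext: "ext (ext X) = ext X"
  by (rule ext_cong) (rule ext_other)

text \<open>The left-hand side of equation \<open>f\<close> after the substitution, an affine
  function of the free variables; \<open>coef f v\<close> below is its coefficient at
  \<open>v\<close>.\<close>

definition val :: "nat \<Rightarrow> (nat \<Rightarrow> bit) \<Rightarrow> bit" where
  "val f X = (\<Sum>v\<in>V f. ext X v)"

text \<open>\<open>infl v u\<close> is the change of \<open>ext X u\<close> when \<open>X v\<close> is flipped; it does not depend on \<open>X\<close>.\<close>

definition infl :: "nat \<Rightarrow> nat \<Rightarrow> bit" where
  "infl v u = (if v \<in> piv ` S then 0
     else if u \<in> piv ` S then of_bool (v \<in> V (the_inv_into S piv u))
     else of_bool (u = v))"

definition coef :: "nat \<Rightarrow> nat \<Rightarrow> bit" where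
  "coef f v = (\<Sum>u\<in>V f. infl v u)"

text \<open>A variable enters the equation solved for a pivot with coefficient 0 or 1, so
  \<open>ext X u\<close> is affine in each variable. For a pivot \<open>v\<close> the slope is 0,
  because \<open>ext\<close> overwrites it.\<close>

lemma ext_upd: "ext (X(v := a)) u = ext (X(v := 0)) u + a * infl v u"
proof (cases "v \<in> piv ` S")
  case True
  then have "ext (X(v := a)) = ext (X(v := 0))" by (intro ext_cong) auto
  with True show ?thesis by (simp add: infl_def)
next
  case v: False
  show ?thesis
  proof (cases "u \<in> piv ` S")
    case True
    then obtain e where e: "e \<in> S" "u = piv e" by blast
    with S_sub have "finite (V e)" by (auto intro: fin)
    moreover have "v \<noteq> piv e" using v e by auto
    moreover have "(\<Sum>w\<in>V e - {piv e}. (X(v := a)) w) = (\<Sum>w\<in>V e - {piv e}. X w)"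
      if "v \<notin> V e" for a
      using that by (intro sum.cong) auto
    ultimately have "(\<Sum>w\<in>V e - {piv e}. (X(v := a)) w) =
      (\<Sum>w\<in>V e - {piv e} - {v}. X w) + a * of_bool (v \<in> V e)" for a
      by (cases "v \<in> V e") (simp_all add: sum.remove[of _ v])
    with e v show ?thesis
      by (simp add: ext_piv infl_def the_inv_into_f_f[OF inj_piv] add.assoc)
  qed (use v in \<open>simp add: ext_other infl_def\<close>)
qed

lemma val_upd: "val f (X(v := a)) = val f (X(v := 0)) + a * coef f v"
  by (simp add: val_def coef_def sum.distrib sum_distrib_left ext_upd[of X v a])

text \<open>This is the test that the program executes. As \<open>X\<close> is arbitrary, any
  leftover assignment will do.\<close>

lemma coef_eq_0_iff: "coef f v = 0 \<longleftrightarrow> val f (X(v := 1)) = val f (X(v := 0))"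
  using val_upd[of f X v 1] by simp

lemma val_upd_coef_0: "coef f v = 0 \<Longrightarrow> val f (X(v := a)) = val f X"
  using val_upd[of f X v a] val_upd[of f X v "X v"] by simp

text \<open>The sum over the free variables of \<open>e\<close> occurs once in the value of the
  pivot and once in \<open>V e\<close>; the two copies cancel in characteristic two.\<close>

lemma val_selected: "e \<in> S \<Longrightarrow> val e X = b e"
proof -
  assume e: "e \<in> S"
  then have "finite (V e)" "piv e \<in> V e" using S_sub fin piv by auto
  then have "val e X = ext X (piv e) + (\<Sum>v\<in>V e - {piv e}. ext X v)"
    by (simp add: val_def sum.remove)
  also have "(\<Sum>v\<in>V e - {piv e}. ext X v) = (\<Sum>v\<in>V e - {piv e}. X v)"
    using e by (intro sum.cong refl ext_other) (auto dest: piv_unique)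
  finally show ?thesis by (simp add: ext_piv e add.assoc)
qed

lemma coef_selected: "e \<in> S \<Longrightarrow> coef e v = 0"
  by (simp add: coef_eq_0_iff[of _ _ "\<lambda>_. 0"] val_selected)

text \<open>A free variable reaches \<open>f\<close> directly and once through every selected
  equation whose pivot is replaced in \<open>f\<close>; the occurrences are counted modulo
  2.\<close>

lemma coef_nonpivot:
  assumes "f < m" "v \<notin> piv ` S"
  shows "coef f v = of_bool (v \<in> V f) + (\<Sum>e | e \<in> S \<and> piv e \<in> V f. of_bool (v \<in> V e))"
proof -
  have f: "finite (V f)" using assms fin by blast
  have "coef f v = (\<Sum>u\<in>V f - piv ` S. infl v u) + (\<Sum>u\<in>V f \<inter> piv ` S. infl v u)"
    unfolding coef_def using f by (subst sum.Int_Diff[of _ _ "piv ` S"]) (auto simp: add.commute)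
  also have "(\<Sum>u\<in>V f - piv ` S. infl v u) = (\<Sum>u\<in>V f - piv ` S. if u = v then 1 else 0)"
    using assms by (intro sum.cong) (auto simp: infl_def)
  also have "\<dots> = of_bool (v \<in> V f)" using f assms by simp
  also have "V f \<inter> piv ` S = piv ` {e \<in> S. piv e \<in> V f}" by auto
  also have "(\<Sum>u\<in>piv ` {e \<in> S. piv e \<in> V f}. infl v u) =
    (\<Sum>e | e \<in> S \<and> piv e \<in> V f. of_bool (v \<in> V e))"
    using assms by (subst sum.reindex)
      (auto intro!: inj_on_subset[OF inj_piv] sum.cong simp: infl_def the_inv_into_f_f[OF inj_piv])
  finally show ?thesis .
qed

text \<open>Two pivots in a fully determined equation would force both blocks into it, giving more than
  \<open>J\<close> variables outside \<open>A\<close>.\<close>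

lemma val_determined:
  assumes f: "f < m" and coef: "\<And>g v. g < m \<Longrightarrow> v \<in> V g \<Longrightarrow> coef f v = 0"
  shows "val f X = b f"
proof -
  define I where "I = {e \<in> S. piv e \<in> V f}"
  have finS: "finite S" using S_sub finite_subset by blast
  have nonpivot: "of_bool (v \<in> V f) + (\<Sum>e\<in>I. of_bool (v \<in> V e)) = (0 :: bit)"
    if "v \<notin> piv ` S" "g < m" "v \<in> V g" for v g
    using coef_nonpivot[OF f that(1)] coef[OF that(2,3)] by (simp add: I_def)
  show ?thesis
  proof (cases "I = {}")
    case True
    \<comment> \<open>With no pivot to replace, any variable of \<open>f\<close> would be free with
      coefficient 1.\<close>
    have "V f = {}"
    proof (rule equals0I)
      fix v assume v: "v \<in> V f"
      with True have "v \<notin> piv ` S" by (auto simp: I_def)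
      from nonpivot[OF this f v] v True show False by simp
    qed
    with f show ?thesis by (simp add: val_def empty_rhs)
  next
    case False
    then obtain e where e: "e \<in> I" by blast
    have sub: "V e - A \<subseteq> V f" if e: "e \<in> I" for e
    proof
      fix v assume v: "v \<in> V e - A"
      have eS: "e \<in> S" "e < m" using e S_sub by (auto simp: I_def)
      show "v \<in> V f"
      proof (cases "v \<in> piv ` S")
        case True
        then obtain e' where "e' \<in> S" "v = piv e'" by blast
        moreover from this v eS have "e' = e" by (auto dest: piv_unique)
        ultimately show ?thesis using e by (simp add: I_def)
      next
        case False
        \<comment> \<open>Outside \<open>A\<close> the blocks are disjoint, so among the equations
          in \<open>I\<close> only \<open>e\<close> contains \<open>v\<close>. The count can be even
          only if \<open>f\<close> contains \<open>v\<close> as well.\<close>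
        have "(\<Sum>e'\<in>I. of_bool (v \<in> V e')) = (\<Sum>e'\<in>I. if e' = e then 1 else (0 :: bit))"
          using v e disj by (intro sum.cong) (auto simp: I_def)
        also have "\<dots> = 1" using e finS by (simp add: I_def)
        finally show ?thesis using nonpivot[OF False eS(2)] v by (simp add: bit_add_eq_0_iff)
      qed
    qed
    have I: "I = {e}"
    proof (rule ccontr)
      assume "I \<noteq> {e}"
      with e obtain e' where e': "e' \<in> I" "e' \<noteq> e" by blast
      have "e \<in> S" "e' \<in> S" using e e' by (auto simp: I_def)
      moreover from this S_sub have "finite (V e)" "finite (V e')" by (auto intro: fin)
      ultimately have "card ((V e - A) \<union> (V e' - A)) = J + J"
        using disj e' by (subst card_Un_disjoint) (auto simp: card_eq)
      moreover have "card ((V e - A) \<union> (V e' - A)) \<le> card (V f - A)"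
        using sub[OF e] sub[OF e'(1)] fin[OF f] by (intro card_mono) auto
      ultimately show False using card_le[OF f] J_pos by simp
    qed
    have eS: "e \<in> S" "e < m" "piv e \<in> V f" using e S_sub by (auto simp: I_def)
    \<comment> \<open>With only \<open>e\<close> substituted, vanishing coefficients say that
      \<open>f\<close> and \<open>e\<close> share their free variables, those inside
      \<open>A\<close> included; the only pivot in either is \<open>piv e\<close>.\<close>
    have "v \<in> V f \<longleftrightarrow> v \<in> V e" for v
    proof (cases "v \<in> piv ` S")
      case True
      then obtain e' where e': "e' \<in> S" "v = piv e'" by blast
      then have "v \<in> V f \<longleftrightarrow> e' \<in> I" by (simp add: I_def)
      also have "\<dots> \<longleftrightarrow> v \<in> V e" using I e' eS piv_unique[of e' e] piv[of e] by auto
      finally show ?thesis .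
    next
      case False
      with nonpivot[OF False f] nonpivot[OF False eS(2)] show ?thesis
        by (auto simp: I split: if_splits)
    qed
    then have "V f = V e" by blast
    with consistent[OF f eS(2)] val_selected[OF eS(1), of X] show ?thesis by (simp add: val_def)
  qed
qed

text \<open>\<open>lst f\<close> is meant as the position of the last free variable on which
  \<open>f\<close> depends, with 0 reserved for determined equations; these are left out and
  accounted for in \<open>majority_final\<close>.\<close>

definition majority :: "(nat \<Rightarrow> nat) \<Rightarrow> (nat \<Rightarrow> nat) \<Rightarrow> nat \<Rightarrow> (nat \<Rightarrow> bit) \<Rightarrow> bool" where
  "majority w lst p X \<longleftrightarrow>
     (\<Sum>f | f < m \<and> 0 < lst f \<and> lst f < p. w f) \<le>
     2 * (\<Sum>f | f < m \<and> 0 < lst f \<and> lst f < p \<and> val f X = b f. w f)"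

text \<open>Equations settled earlier do not depend on \<open>v\<close> and keep their status. Those
  with \<open>lst f = p\<close> all flip with \<open>v\<close>, so the better value of
  \<open>v\<close> satisfies weight \<open>max sat unsat\<close>, at least half of
  \<open>sat + unsat\<close>.\<close>

lemma majority_step:
  assumes maj: "majority w lst p X" and p: "0 < p"
    and one: "\<And>f. f < m \<Longrightarrow> lst f = p \<Longrightarrow> coef f v = 1"
    and zero: "\<And>f. f < m \<Longrightarrow> 0 < lst f \<Longrightarrow> lst f < p \<Longrightarrow> coef f v = 0"
    and sat: "sat = (\<Sum>f | f < m \<and> lst f = p \<and> val f (X(v := 0)) = b f. w f)"
    and unsat: "unsat = (\<Sum>f | f < m \<and> lst f = p \<and> val f (X(v := 0)) \<noteq> b f. w f)"
  shows "majority w lst (Suc p) (X(v := (if sat < unsat then 1 else 0)))"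
proof -
  define X' where "X' = X(v := (if sat < unsat then 1 else 0))"
  have flip: "val f (X(v := 1)) = b f \<longleftrightarrow> val f (X(v := 0)) \<noteq> b f" if "f < m" "lst f = p" for f
    using val_upd[of f X v 1] one[OF that] bit_cases_01[of "val f (X(v := 0))"] bit_cases_01[of "b f"]
    by auto
  have old: "{f. f < m \<and> 0 < lst f \<and> lst f < p \<and> val f X' = b f} =
    {f. f < m \<and> 0 < lst f \<and> lst f < p \<and> val f X = b f}"
    by (auto simp: X'_def val_upd_coef_0 zero)
  have *: "(\<Sum>f | f < m \<and> 0 < lst f \<and> lst f < Suc p \<and> P f. w f) =
    (\<Sum>f | f < m \<and> 0 < lst f \<and> lst f < p \<and> P f. w f) + (\<Sum>f | f < m \<and> lst f = p \<and> P f. w f)" for P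
    using p by (subst sum.union_disjoint[symmetric]) (auto intro!: sum.cong)
  have tot: "(\<Sum>f | f < m \<and> lst f = p. w f) = sat + unsat"
    unfolding sat unsat by (subst sum.union_disjoint[symmetric]) (auto intro!: sum.cong)
  have "(\<Sum>f | f < m \<and> lst f = p \<and> val f X' = b f. w f) = max sat unsat"
  proof (cases "sat < unsat")
    case True
    have "(\<Sum>f | f < m \<and> lst f = p \<and> val f X' = b f. w f) = unsat"
      unfolding unsat using True flip by (intro sum.cong) (auto simp: X'_def)
    with True show ?thesis by simp
  next
    case False
    then show ?thesis by (simp add: X'_def sat)
  qed
  with maj tot *[of "\<lambda>_. True"] *[of "\<lambda>f. val f X' = b f"] old show ?thesis
    by (simp add: majority_def X'_def[symmetric])
qed

text \<open>The surplus comes from the equations with \<open>lst f = 0\<close>: all of them are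
  satisfied by \<open>val_determined\<close>, and they include \<open>S\<close>, whose weight is at
  least \<open>card S\<close>.\<close>

lemma majority_final:
  assumes maj: "majority w lst p X" and w: "\<And>f. f < m \<Longrightarrow> 0 < w f"
    and p: "\<And>f. f < m \<Longrightarrow> lst f < p"
    and zero: "\<And>f g v. f < m \<Longrightarrow> lst f = 0 \<Longrightarrow> g < m \<Longrightarrow> v \<in> V g \<Longrightarrow> coef f v = 0"
    and sel: "\<And>e. e \<in> S \<Longrightarrow> lst e = 0"
  shows "(\<Sum>f<m. w f) + card S \<le> 2 * (\<Sum>f | f < m \<and> val f X = b f. w f)"
proof -
  let ?Z = "\<Sum>f | f < m \<and> lst f = 0. w f"
  have "card S \<le> (\<Sum>f\<in>S. w f)"
  proof -
    have "(\<Sum>f\<in>S. 1) \<le> (\<Sum>f\<in>S. w f)" using S_sub w by (intro sum_mono) fastforce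
    then show ?thesis by simp
  qed
  also have "\<dots> \<le> ?Z" using S_sub sel by (intro sum_mono2) auto
  finally have Z: "card S \<le> ?Z" .
  have 1: "(\<Sum>f<m. w f) = ?Z + (\<Sum>f | f < m \<and> 0 < lst f \<and> lst f < p. w f)"
    using p by (subst sum.union_disjoint[symmetric]) (auto intro!: sum.cong)
  have 2: "(\<Sum>f | f < m \<and> val f X = b f. w f) =
      ?Z + (\<Sum>f | f < m \<and> 0 < lst f \<and> lst f < p \<and> val f X = b f. w f)"
    using p val_determined[of _ X] zero
    by (subst sum.union_disjoint[symmetric]) (auto intro!: sum.cong)
  from Z maj show ?thesis unfolding 1 2 majority_def by simp
qed

end

section \<open>The program\<close>

definition nat_of_bit :: "bit \<Rightarrow> nat" where
  "nat_of_bit x = (if x = 1 then 1 else 0)"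

lemma nat_of_bit_simps [simp]: "nat_of_bit 0 = 0" "nat_of_bit 1 = 1"
  by (simp_all add: nat_of_bit_def)

lemma nat_of_bit_inject [simp]: "nat_of_bit x = nat_of_bit y \<longleftrightarrow> x = y"
  using bit_cases_01[of x] bit_cases_01[of y] by (auto simp: nat_of_bit_def)

text \<open>Truncated subtraction in both directions gives the absolute difference, which on 0 and 1
  is addition modulo 2; hence the expression \<open>Xor\<close>.\<close>

lemma nat_of_bit_add:
  "nat_of_bit x - nat_of_bit y + (nat_of_bit y - nat_of_bit x) = nat_of_bit (x + y)"
  using bit_cases_01[of x] bit_cases_01[of y] by (auto simp: nat_of_bit_def)

text \<open>Names of arrays (\<open>a_\<dots>\<close>) and of registers (\<open>r_\<dots>\<close>, arrays of which only cell \<open>0\<close> is used).\<close>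

abbreviation (input) a_in :: nat where "a_in \<equiv> 0"
abbreviation (input) a_out :: nat where "a_out \<equiv> 1"
abbreviation (input) a_beg :: nat where "a_beg \<equiv> 2"
abbreviation (input) a_asg :: nat where "a_asg \<equiv> 3"
abbreviation (input) a_cov :: nat where "a_cov \<equiv> 4"
abbreviation (input) a_lev :: nat where "a_lev \<equiv> 5"
abbreviation (input) a_piv :: nat where "a_piv \<equiv> 6"
abbreviation (input) a_last :: nat where "a_last \<equiv> 7"
abbreviation (input) r_j :: nat where "r_j \<equiv> 8"
abbreviation (input) r_e :: nat where "r_e \<equiv> 9"
abbreviation (input) r_f :: nat where "r_f \<equiv> 10"
abbreviation (input) r_p :: nat where "r_p \<equiv> 11"
abbreviation (input) r_v :: nat where "r_v \<equiv> 12"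
abbreviation (input) r_acc :: nat where "r_acc \<equiv> 13"
abbreviation (input) r_cnt :: nat where "r_cnt \<equiv> 14"
abbreviation (input) r_sel :: nat where "r_sel \<equiv> 15"
abbreviation (input) r_old :: nat where "r_old \<equiv> 16"
abbreviation (input) r_sat :: nat where "r_sat \<equiv> 17"
abbreviation (input) r_unsat :: nat where "r_unsat \<equiv> 18"

abbreviation Eq :: "aexp \<Rightarrow> aexp \<Rightarrow> bexp" where
  "Eq a b \<equiv> And (Not (Less a b)) (Not (Less b a))"

abbreviation Xor :: "aexp \<Rightarrow> aexp \<Rightarrow> aexp" where
  "Xor a b \<equiv> Plus (Minus a b) (Minus b a)"

lemma bval_Eq: "bval (Eq a b) s \<longleftrightarrow> aval a s = aval b s"
  by auto

text \<open>Cell 0 holds the input length, cell 1 holds \<open>k\<close> and cell 2 the number of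
  equations, so the first equation starts at cell 3. Its length entry, right-hand side and weight
  account for the constant 3 in the increment. One start beyond the last equation is stored too:
  right-hand side and weight are addressed backwards from the next start.\<close>

definition parse :: com where
  "parse = Seq (Store a_beg (Const 0) (Const 3))
     (For r_e (Const 0) (Arr a_in (Const 2))
       (Store a_beg (Plus (Var r_e) (Const 1))
          (Plus (Plus (Arr a_beg (Var r_e)) (Arr a_in (Arr a_beg (Var r_e)))) (Const 3))))"

definition for_eqn :: "nat \<Rightarrow> com \<Rightarrow> com" where
  "for_eqn i P = For r_v (Plus (Arr a_beg (Var i)) (Const 1))
     (Minus (Arr a_beg (Plus (Var i) (Const 1))) (Const 2)) P"

abbreviation cur_var :: aexp where "cur_var \<equiv> Arr a_in (Var r_v)"

definition eqn_rhs :: "nat \<Rightarrow> aexp" where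
  "eqn_rhs i = Arr a_in (Minus (Arr a_beg (Plus (Var i) (Const 1))) (Const 2))"

definition eqn_wt :: "nat \<Rightarrow> aexp" where
  "eqn_wt i = Arr a_in (Minus (Arr a_beg (Plus (Var i) (Const 1))) (Const 1))"

lemma writes_for_eqn [simp]: "writes (for_eqn i P) = insert r_v (writes P)"
  by (simp add: for_eqn_def)

section \<open>Layout of an encoded instance in memory\<close>

locale lin_instance =
  fixes c :: nat and F :: lin_system and k L :: nat
  assumes sys: "max_lin2_system c F"
    and len_le: "length (encode_instance (F, k)) \<le> L" and c_le: "c \<le> L"
begin

abbreviation m :: nat where "m \<equiv> length F"
abbreviation V :: "nat \<Rightarrow> nat set" where "V f \<equiv> vars (F ! f)"
abbreviation b :: "nat \<Rightarrow> bit" where "b f \<equiv> rhs (F ! f)"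
abbreviation w :: "nat \<Rightarrow> nat" where "w f \<equiv> wt (F ! f)"
abbreviation len :: nat where "len \<equiv> length (encode_instance (F, k))"

definition cell :: "nat \<Rightarrow> nat" where
  "cell = input_state (encode_instance (F, k)) 0"

definition start :: "nat \<Rightarrow> nat" where
  "start f = 3 + (\<Sum>g<f. card (V g) + 3)"

lemma finV: "f < m \<Longrightarrow> finite (V f)"
  using sys by (simp add: max_lin2_system_def)

lemma card_V_le: "f < m \<Longrightarrow> card (V f) \<le> c"
  using sys by (simp add: max_lin2_system_def)

lemma w_pos: "f < m \<Longrightarrow> 0 < w f"
  using sys by (simp add: max_lin2_system_def)

lemma rhs_if_empty: "f < m \<Longrightarrow> V f = {} \<Longrightarrow> b f = 0"
  using sys bit_cases_01[of "b f"] by (auto simp: max_lin2_system_def)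

lemma start_0: "start 0 = 3"
  by (simp add: start_def)

lemma start_Suc: "start (Suc f) = start f + card (V f) + 3"
  by (simp add: start_def)

lemma length_encode_eqn: "f < m \<Longrightarrow> length (encode_eqn (F ! f)) = card (V f) + 3"
  by (simp add: encode_eqn_def)

lemma start_eq: "f \<le> m \<Longrightarrow> start f = 3 + length (concat (map encode_eqn (take f F)))"
  by (induction f) (simp_all add: start_0 start_Suc take_Suc_conv_app_nth length_encode_eqn)

lemma start_m: "start m = Suc len"
  by (simp add: start_eq)

lemma start_mono: "f \<le> g \<Longrightarrow> start f \<le> start g"
  unfolding start_def by (intro add_left_mono sum_mono2) auto

lemma m_le: "m \<le> L"
proof -
  have "m \<le> (\<Sum>g<m. card (V g) + 3)"
    using sum_mono[of "{..<m}" "\<lambda>_. 1" "\<lambda>g. card (V g) + 3"] by simp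
  then have "m \<le> len" using start_m by (simp add: start_def)
  with len_le show ?thesis by simp
qed

lemma cell_0: "cell 0 = len"
  by (simp add: cell_def input_state_def)

lemma cell_1: "cell 1 = k"
  by (simp add: cell_def input_state_def)

lemma cell_2: "cell 2 = m"
  by (simp add: cell_def input_state_def)

lemma cell_start:
  assumes f: "f < m" and i: "i < card (V f) + 3"
  shows "cell (start f + i) = encode_eqn (F ! f) ! i"
proof -
  let ?A = "concat (map encode_eqn (take f F))" and ?B = "concat (map encode_eqn (drop (Suc f) F))"
  have "concat (map encode_eqn F) = ?A @ encode_eqn (F ! f) @ ?B"
    using arg_cong[OF id_take_nth_drop[OF f], of "\<lambda>F. concat (map encode_eqn F)"] by simp
  then have "encode_instance (F, k) = (k # m # ?A) @ encode_eqn (F ! f) @ ?B"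
    by simp
  moreover have "start f + i \<le> len"
    using start_mono[of "Suc f" m] f i by (simp add: start_Suc start_m)
  moreover have "start f = 3 + length ?A" using f by (simp add: start_eq)
  ultimately show ?thesis
    using i f by (simp add: cell_def input_state_def nth_append length_encode_eqn)
qed

lemma cell_card: "f < m \<Longrightarrow> cell (start f) = card (V f)"
  using cell_start[of f 0] by (simp add: encode_eqn_def)

lemma cell_var: "f < m \<Longrightarrow> i < card (V f) \<Longrightarrow> cell (start f + Suc i) = sorted_list_of_set (V f) ! i"
  using cell_start[of f "Suc i"] by (simp add: encode_eqn_def nth_append)

lemma cell_rhs: "f < m \<Longrightarrow> cell (start (Suc f) - 2) = nat_of_bit (b f)"
  using cell_start[of f "Suc (card (V f))"]
  by (simp add: start_Suc encode_eqn_def nth_append nat_of_bit_def)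

lemma cell_wt: "f < m \<Longrightarrow> cell (start (Suc f) - 1) = w f"
  using cell_start[of f "Suc (Suc (card (V f)))"] by (simp add: start_Suc encode_eqn_def nth_append)

text \<open>Each variable of an equation is listed exactly once, so a loop over the cells computes a
  sum or a cardinality over \<open>V f\<close>.\<close>

lemma bij_cell:
  assumes "f < m"
  shows "bij_betw cell {start f + 1..<start f + 1 + card (V f)} (V f)"
proof -
  let ?l = "sorted_list_of_set (V f)"
  have "bij_betw ((!) ?l) {..<card (V f)} (V f)"
    using finV[OF assms] by (intro bij_betw_nth) auto
  moreover have "bij_betw (\<lambda>p. p - (start f + 1)) {start f + 1..<start f + 1 + card (V f)} {..<card (V f)}"
    by (rule bij_betw_byWitness[where f' = "\<lambda>i. i + (start f + 1)"]) auto
  ultimately have "bij_betw ((!) ?l \<circ> (\<lambda>p. p - (start f + 1))) {start f + 1..<start f + 1 + card (V f)} (V f)"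
    by (rule bij_betw_trans[rotated])
  moreover have "cell p = ((!) ?l \<circ> (\<lambda>p. p - (start f + 1))) p"
    if "p \<in> {start f + 1..<start f + 1 + card (V f)}" for p
    using cell_var[OF assms, of "p - (start f + 1)"] that by (auto simp: less_diff_conv2)
  ultimately show ?thesis using bij_betw_cong by blast
qed

text \<open>Guarantees that loops over all input cells reach every variable of the system.\<close>

lemma var_cell:
  assumes "f < m" "v \<in> V f"
  shows "\<exists>p. 0 < p \<and> p \<le> len \<and> cell p = v"
proof -
  from bij_cell[OF assms(1)] assms(2) have "v \<in> cell ` {start f + 1..<start f + 1 + card (V f)}"
    by (simp add: bij_betw_def)
  then obtain p where "p \<in> {start f + 1..<start f + 1 + card (V f)}" "cell p = v"
    by blast
  moreover have "start f + card (V f) + 3 \<le> Suc len"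
    using start_mono[of "Suc f" m] assms by (simp add: start_Suc start_m)
  ultimately show ?thesis by (intro exI[of _ p]) auto
qed

definition parsed :: "ram_state \<Rightarrow> bool" where
  "parsed s \<longleftrightarrow> s a_in = cell \<and> (\<forall>f\<le>m. s a_beg f = start f)"

lemma parsed_simps:
  "parsed s \<Longrightarrow> s a_in p = cell p"
  "parsed s \<Longrightarrow> f \<le> m \<Longrightarrow> s a_beg f = start f"
  by (simp_all add: parsed_def)

lemma wp_parse: "s a_in = cell \<Longrightarrow> wp L parse parsed s"
  unfolding parse_def wp.simps
  apply (rule wp_For[where lo = 0 and hi = m and
        I = "\<lambda>n s. s a_in = cell \<and> (\<forall>f\<le>n. s a_beg f = start f)"])
  by (auto simp: cell_2 m_le start_0 start_Suc parsed_def cell_card le_Suc_eq)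

lemma eqn_rhs_eq: "parsed s \<Longrightarrow> s i 0 < m \<Longrightarrow> aval (eqn_rhs i) s = nat_of_bit (b (s i 0))"
  by (simp add: eqn_rhs_def parsed_simps flip: cell_rhs)

lemma eqn_wt_eq: "parsed s \<Longrightarrow> s i 0 < m \<Longrightarrow> aval (eqn_wt i) s = w (s i 0)"
  by (simp add: eqn_wt_def parsed_simps flip: cell_wt)

text \<open>Replaces the counter by the set \<open>U\<close> of variables already visited, so that
  later invariants need not mention positions; \<open>v \<notin> U\<close> is what sums and
  cardinalities need for their update.\<close>

lemma wp_for_eqn:
  assumes s: "parsed s" and f: "f < m" "s i 0 = f"
    and P: "r_v \<notin> writes P" "a_in \<notin> writes P" "a_beg \<notin> writes P" "i \<notin> writes P" "i \<noteq> r_v"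
    and init: "I {} s"
    and cong: "\<And>U s' f. I U s' \<Longrightarrow> I U (s'(r_v := f))"
    and step: "\<And>U v s'. U \<subseteq> V f \<Longrightarrow> v \<in> V f \<Longrightarrow> v \<notin> U \<Longrightarrow>
      \<forall>j. j \<notin> insert r_v (writes P) \<longrightarrow> s' j = s j \<Longrightarrow> s' a_in (s' r_v 0) = v \<Longrightarrow> I U s' \<Longrightarrow>
      wp L P (I (insert v U)) s'"
    and post: "\<And>s'. \<forall>j. j \<notin> insert r_v (writes P) \<longrightarrow> s' j = s j \<Longrightarrow> I (V f) s' \<Longrightarrow> Q s'"
  shows "wp L (for_eqn i P) Q s"
  unfolding for_eqn_def
proof (rule wp_For[where lo = "start f + 1" and hi = "start f + 1 + card (V f)"
        and I = "\<lambda>n. I (cell ` {start f + 1..<n})"])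
  show "aval (Plus (Arr a_beg (Var i)) (Const 1)) s = start f + 1"
    using s f by (simp add: parsed_simps)
  show "start f + 1 + card (V f) \<le> start f + 1 + L"
    using card_V_le[OF f(1)] c_le by simp
next
  fix s' :: ram_state assume "\<forall>j. j \<notin> insert r_v (writes P) \<longrightarrow> s' j = s j"
  then have "s' a_beg = s a_beg" "s' i = s i" using P by auto
  then show "aval (Minus (Arr a_beg (Plus (Var i) (Const 1))) (Const 2)) s' = start f + 1 + card (V f)"
    using s f by (simp add: parsed_simps start_Suc)
next
  fix n and s' :: ram_state
  assume n: "start f + 1 \<le> n" "n < start f + 1 + card (V f)"
    and fr: "\<forall>j. j \<notin> insert r_v (writes P) \<longrightarrow> s' j = s j" and "s' r_v 0 = n"
    and I: "I (cell ` {start f + 1..<n}) s'"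
  have bij: "bij_betw cell {start f + 1..<start f + 1 + card (V f)} (V f)"
    using f(1) by (rule bij_cell)
  have "s' a_in = s a_in" using fr P by auto
  have "wp L P (I (insert (cell n) (cell ` {start f + 1..<n}))) s'"
  proof (rule step[OF _ _ _ fr _ I])
    show "cell ` {start f + 1..<n} \<subseteq> V f" "cell n \<in> V f"
      using n bij unfolding bij_betw_def by fastforce+
    show "cell n \<notin> cell ` {start f + 1..<n}"
      using n bij unfolding bij_betw_def inj_on_def by fastforce
    show "s' a_in (s' r_v 0) = cell n"
      using \<open>s' a_in = s a_in\<close> \<open>s' r_v 0 = n\<close> s by (simp add: parsed_simps)
  qed
  also have "insert (cell n) (cell ` {start f + 1..<n}) = cell ` {start f + 1..<Suc n}"
    using n by (auto simp: less_Suc_eq)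
  finally show "wp L P (I (cell ` {start f + 1..<Suc n})) s'" .
next
  fix s' assume "\<forall>j. j \<notin> insert r_v (writes P) \<longrightarrow> s' j = s j"
    "I (cell ` {start f + 1..<start f + 1 + card (V f)}) s'"
  moreover have "cell ` {start f + 1..<start f + 1 + card (V f)} = V f"
    using bij_cell[OF f(1)] by (simp add: bij_betw_def)
  ultimately show "Q s'" by (intro post) auto
qed (use P init cong in auto)

end

section \<open>Programs for substitution, dependence test and majority choice\<close>

definition parity :: "nat \<Rightarrow> com" where
  "parity i = Seq (Set r_acc (Const 0)) (for_eqn i (Set r_acc (Xor (Var r_acc) (Arr a_asg cur_var))))"

text \<open>The pivot is set to 0 beforehand, so that the parity of the whole equation is the parity
  of its other variables.\<close>

definition extend_step :: com where
  "extend_step =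
     Cond (Eq (Arr a_lev (Var r_e)) (Var r_sel))
        (Seq (Store a_asg (Arr a_piv (Var r_e)) (Const 0))
        (Seq (parity r_e)
             (Store a_asg (Arr a_piv (Var r_e)) (Xor (Var r_acc) (eqn_rhs r_e)))))
        Skip"

definition extend :: com where
  "extend = For r_e (Const 0) (Arr a_in (Const 2)) extend_step"

text \<open>The loops over \<open>r_p\<close> run through all input cells and treat every entry as a variable, including
  those that encode lengths, right-hand sides or weights: assigning a value to a variable that does not
  occur is harmless.\<close>

definition find_last_step :: com where
  "find_last_step =
     Seq (Store a_asg (Arr a_in (Var r_p)) (Const 1))
    (Seq extend
    (Seq (parity r_f)
    (Seq (Set r_old (Var r_acc))
    (Seq (Store a_asg (Arr a_in (Var r_p)) (Const 0))
    (Seq extend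
    (Seq (parity r_f)
         (Cond (Eq (Var r_old) (Var r_acc)) Skip (Store a_last (Var r_f) (Var r_p)))))))))"

text \<open>Positions ascend and overwrite \<open>a_last\<close>, so the last dependence survives.
  Position 0 is never tried, which leaves the initial value 0 as the mark of a determined
  equation.\<close>

definition find_last :: com where
  "find_last = For r_p (Const 1) (Plus (Arr a_in (Const 0)) (Const 1))
     (For r_f (Const 0) (Arr a_in (Const 2)) find_last_step)"

definition tally_step :: com where
  "tally_step =
     Cond (Eq (Arr a_last (Var r_f)) (Var r_p))
       (Seq (parity r_f)
            (Cond (Eq (Var r_acc) (eqn_rhs r_f))
               (Set r_sat (Plus (Var r_sat) (eqn_wt r_f)))
               (Set r_unsat (Plus (Var r_unsat) (eqn_wt r_f)))))
       Skip"

definition tally :: com where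
  "tally = For r_f (Const 0) (Arr a_in (Const 2)) tally_step"

definition assign_step :: com where
  "assign_step =
     Seq (Store a_asg (Arr a_in (Var r_p)) (Const 0))
    (Seq extend
    (Seq (Set r_sat (Const 0))
    (Seq (Set r_unsat (Const 0))
    (Seq tally
         (Cond (Less (Var r_sat) (Var r_unsat))
            (Store a_asg (Arr a_in (Var r_p)) (Const 1)) Skip)))))"

definition assign :: com where
  "assign = For r_p (Const 1) (Plus (Arr a_in (Const 0)) (Const 1)) assign_step"

text \<open>A variable may be output once per cell that contains its number; repetitions are
  harmless, as decoding uses only the set of entries. The length cell doubles as the write
  pointer.\<close>

definition emit :: com where
  "emit = For r_p (Const 1) (Plus (Arr a_in (Const 0)) (Const 1))
     (Cond (Less (Const 0) (Arr a_asg (Arr a_in (Var r_p))))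
        (Seq (Store a_out (Plus (Var a_out) (Const 1)) (Arr a_in (Var r_p)))
             (Set a_out (Plus (Var a_out) (Const 1))))
        Skip)"

lemma writes_parity [simp]: "writes (parity i) = {r_acc, r_v}"
  by (auto simp: parity_def)

lemma writes_extend_step [simp]: "writes extend_step = {a_asg, r_acc, r_v}"
  by (auto simp: extend_step_def)

lemma writes_extend [simp]: "writes extend = {r_e, a_asg, r_acc, r_v}"
  by (auto simp: extend_def)

lemma writes_find_last_step [simp]:
  "writes find_last_step = {r_e, a_asg, r_acc, r_v, r_old, a_last}"
  by (auto simp: find_last_step_def)

lemma writes_find_last [simp]: "writes find_last = {r_p, r_f, r_e, a_asg, r_acc, r_v, r_old, a_last}"
  by (auto simp: find_last_def)

lemma writes_tally_step [simp]: "writes tally_step = {r_acc, r_v, r_sat, r_unsat}"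
  by (auto simp: tally_step_def)

lemma writes_tally [simp]: "writes tally = {r_f, r_acc, r_v, r_sat, r_unsat}"
  by (auto simp: tally_def)

lemma writes_assign_step [simp]: "writes assign_step = {r_f, r_e, a_asg, r_acc, r_v, r_sat, r_unsat}"
  by (auto simp: assign_step_def)

lemma writes_assign [simp]: "writes assign = {r_p, r_f, r_e, a_asg, r_acc, r_v, r_sat, r_unsat}"
  by (auto simp: assign_def)

definition bits :: "(nat \<Rightarrow> bit) \<Rightarrow> nat \<Rightarrow> nat" where
  "bits X = (\<lambda>v. nat_of_bit (X v))"

lemma bits_upd: "(bits X)(v := nat_of_bit a) = bits (X(v := a))"
  by (auto simp: bits_def)

lemma bits_upd_0: "(bits X)(v := 0) = bits (X(v := 0))"
  using bits_upd[of X v 0] by simp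

lemma bits_upd_1: "(bits X)(v := Suc 0) = bits (X(v := 1))"
  using bits_upd[of X v 1] by simp

context lin_instance
begin

lemma wp_parity:
  assumes s: "parsed s" "s a_asg = bits X" "s i 0 = f" "f < m" and i: "i \<notin> {r_v, r_acc}"
    and post: "\<And>s'. \<forall>j. j \<notin> {r_v, r_acc} \<longrightarrow> s' j = s j \<Longrightarrow>
      s' r_acc 0 = nat_of_bit (\<Sum>v\<in>V f. X v) \<Longrightarrow> Q s'"
  shows "wp L (parity i) Q s"
  unfolding parity_def wp.simps
proof (rule wp_for_eqn[where f = f and I = "\<lambda>U s'. s' r_acc 0 = nat_of_bit (\<Sum>v\<in>U. X v)"])
  fix U v s'
  assume U: "U \<subseteq> V f" "v \<in> V f" "v \<notin> U" and "s' a_in (s' r_v 0) = v"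
    "s' r_acc 0 = nat_of_bit (\<Sum>v\<in>U. X v)"
    "\<forall>j. j \<notin> insert r_v (writes (Set r_acc (Xor (Var r_acc) (Arr a_asg cur_var)))) \<longrightarrow>
      s' j = (s(r_acc := (s r_acc)(aval (Const 0) s := aval (Const 0) s))) j"
  moreover from U s have "finite U" using finV finite_subset by blast
  ultimately show "wp L (Set r_acc (Xor (Var r_acc) (Arr a_asg cur_var)))
    (\<lambda>s'. s' r_acc 0 = nat_of_bit (\<Sum>v\<in>insert v U. X v)) s'"
    using s by (simp add: bits_def nat_of_bit_add add.commute[of "X v"])
next
  fix s'
  assume "\<forall>j. j \<notin> insert r_v (writes (Set r_acc (Xor (Var r_acc) (Arr a_asg cur_var)))) \<longrightarrow>
      s' j = (s(r_acc := (s r_acc)(aval (Const 0) s := aval (Const 0) s))) j"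
    "s' r_acc 0 = nat_of_bit (\<Sum>v\<in>V f. X v)"
  then show "Q s'" by (intro post) auto
qed (use s i in \<open>auto simp: parsed_def\<close>)

end

locale lin_selection = lin_instance c F k L +
  pivot_system "length F" "\<lambda>f. vars (F ! f)" "\<lambda>f. rhs (F ! f)"
    "{e. e < length F \<and> lev e = J}" piv A J
  for c F k L lev piv A J
begin

definition ready :: "ram_state \<Rightarrow> bool" where
  "ready s \<longleftrightarrow> parsed s \<and> s r_sel 0 = J \<and> (\<forall>e<m. s a_lev e = lev e) \<and>
     (\<forall>e<m. lev e = J \<longrightarrow> s a_piv e = piv e)"

lemma ready_parsed: "ready s \<Longrightarrow> parsed s"
  by (simp add: ready_def)

lemma ready_frame:
  "ready s \<Longrightarrow> s' a_in = s a_in \<Longrightarrow> s' a_beg = s a_beg \<Longrightarrow> s' r_sel = s r_sel \<Longrightarrow>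
   s' a_lev = s a_lev \<Longrightarrow> s' a_piv = s a_piv \<Longrightarrow> ready s'"
  by (simp add: ready_def parsed_def)

text \<open>Lets the program change variables in an already extended assignment: stale pivot values
  disappear at the next extension.\<close>

lemma ext_upd_ext: "ext ((ext X)(v := a)) = ext (X(v := a))"
  by (rule ext_cong) (simp add: ext_other)

text \<open>\<open>Y n\<close> has only the pivots of the selected equations below \<open>n\<close>
  replaced. Working in place is sound because none of these pivots occurs in a later selected
  equation.\<close>

lemma wp_extend:
  assumes s: "ready s" "s a_asg = bits X"
    and post: "\<And>s'. \<forall>j. j \<notin> {r_e, a_asg, r_acc, r_v} \<longrightarrow> s' j = s j \<Longrightarrow>
      s' a_asg = bits (ext X) \<Longrightarrow> Q s'"
  shows "wp L extend Q s"
proof -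
  define S where "S = {e. e < m \<and> lev e = J}"
  define Y where "Y n = (\<lambda>v. if v \<in> piv ` {e\<in>S. e < n} then ext X v else X v)" for n
  show ?thesis
    unfolding extend_def
  proof (rule wp_For[where lo = 0 and hi = m and I = "\<lambda>n s'. s' a_asg = bits (Y n)"])
    fix n s'
    assume n: "n < m" "s' r_e 0 = n" "s' a_asg = bits (Y n)"
      and "\<forall>j. j \<notin> insert r_e (writes extend_step) \<longrightarrow> s' j = s j"
    then have fr: "\<forall>j. j \<notin> {r_e, a_asg, r_acc, r_v} \<longrightarrow> s' j = s j" by auto
    then have r: "ready s'" using s by (auto intro: ready_frame)
    show "wp L extend_step (\<lambda>s'. s' a_asg = bits (Y (Suc n))) s'"
    proof (cases "lev n = J")
      case False
      then have "{e\<in>S. e < Suc n} = {e\<in>S. e < n}" by (auto simp: S_def less_Suc_eq)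
      with False n r show ?thesis by (auto simp: extend_step_def ready_def Y_def)
    next
      case True
      with n have nS: "n \<in> S" by (simp add: S_def)
      have Y: "Y (Suc n) = (Y n)(piv n := ext X (piv n))"
        using nS by (auto simp: Y_def less_Suc_eq fun_eq_iff)
      have pn: "s' a_piv n = piv n" using r n True by (simp add: ready_def)
      have sum: "(\<Sum>v\<in>V n. ((Y n)(piv n := 0)) v) = (\<Sum>v\<in>V n - {piv n}. X v)"
      proof -
        have "piv n \<in> V n" using nS piv[of n] by (simp add: S_def)
        then have "(\<Sum>v\<in>V n. ((Y n)(piv n := 0)) v) = (\<Sum>v\<in>V n - {piv n}. ((Y n)(piv n := 0)) v)"
          using n finV by (simp add: sum.remove[of _ "piv n"])
        also have "\<dots> = (\<Sum>v\<in>V n - {piv n}. X v)"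
        proof (intro sum.cong refl)
          fix v assume "v \<in> V n - {piv n}"
          have "v \<notin> piv ` {e\<in>S. e < n}"
          proof
            assume "v \<in> piv ` {e\<in>S. e < n}"
            then obtain e where "e \<in> S" "e < n" "v = piv e" by auto
            with nS piv_unique[of e n] \<open>v \<in> V n - {piv n}\<close> show False by (simp add: S_def)
          qed
          with \<open>v \<in> V n - {piv n}\<close> show "((Y n)(piv n := 0)) v = X v" by (simp add: Y_def)
        qed
        finally show ?thesis .
      qed
      have "wp L (parity r_e) (\<lambda>t. (t a_asg)(t a_piv n := aval (Xor (Var r_acc) (eqn_rhs r_e)) t) =
          bits (Y (Suc n)) \<and> t r_e 0 = n) (s'(a_asg := bits ((Y n)(piv n := 0))))"
      proof (rule wp_parity[where f = n and X = "(Y n)(piv n := 0)"])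
        show "parsed (s'(a_asg := bits ((Y n)(piv n := 0))))"
          using r by (auto simp: ready_def parsed_def)
        fix t assume frt: "\<forall>j. j \<notin> {r_v, r_acc} \<longrightarrow> t j = (s'(a_asg := bits ((Y n)(piv n := 0)))) j"
          and acc: "t r_acc 0 = nat_of_bit (\<Sum>v\<in>V n. ((Y n)(piv n := 0)) v)"
        have pt: "parsed t" using r frt by (simp add: ready_def parsed_def)
        have te: "t r_e 0 = n" "t a_piv n = piv n" "t a_asg = bits ((Y n)(piv n := 0))"
          using frt n pn by simp_all
        have "aval (eqn_rhs r_e) t = nat_of_bit (b n)"
          using eqn_rhs_eq[OF pt, of r_e] te n by simp
        then have "aval (Xor (Var r_acc) (eqn_rhs r_e)) t = nat_of_bit (ext X (piv n))"
          using acc nS by (simp add: nat_of_bit_add sum ext_piv S_def add.commute[of "b n"] del: fun_upd_apply)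
        then show "(t a_asg)(t a_piv n := aval (Xor (Var r_acc) (eqn_rhs r_e)) t) =
          bits (Y (Suc n)) \<and> t r_e 0 = n"
          by (simp only: te bits_upd Y fun_upd_upd simp_thms)
      qed (use n in auto)
      then have "wp L (parity r_e) (\<lambda>t. (t a_asg)(t a_piv (t r_e 0) := aval (Xor (Var r_acc) (eqn_rhs r_e)) t) =
          bits (Y (Suc n))) (s'(a_asg := bits ((Y n)(piv n := 0))))"
        by (rule wp_mono) auto
      with True n r pn show ?thesis by (simp add: extend_step_def ready_def bits_upd_0)
    qed
  next
    fix s'
    assume "s' a_asg = bits (Y m)"
      and "\<forall>j. j \<notin> insert r_e (writes extend_step) \<longrightarrow> s' j = s j"
    moreover have "Y m = ext X"
    proof -
      have "{e\<in>S. e < m} = {e. e < m \<and> lev e = J}" by (auto simp: S_def)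
      then show ?thesis by (auto simp: Y_def ext_other fun_eq_iff)
    qed
    ultimately show "Q s'" by (intro post) auto
  qed (use s in \<open>auto simp: ready_def parsed_def cell_2 m_le Y_def S_def\<close>)
qed

end

section \<open>Last free variables and the majority assignment\<close>

context lin_selection
begin

lemma val_ext: "val f (ext X) = val f X"
  by (simp add: val_def ext_ext)

lemma val_upd_ext: "val f ((ext X)(v := a)) = val f (X(v := a))"
  by (simp add: val_def ext_upd_ext)

text \<open>The assignment left behind is arbitrary in \<open>post\<close>: it is scratch, since the
  outcome of the test does not depend on it.\<close>

lemma wp_find_last_step:
  assumes s: "ready s" "s a_asg = bits X" "s r_f 0 = f" "f < m" "s r_p 0 = p"
    and post: "\<And>s' Y. \<forall>j. j \<notin> {r_e, a_asg, r_acc, r_v, r_old, a_last} \<longrightarrow> s' j = s j \<Longrightarrow>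
      s' a_asg = bits Y \<Longrightarrow>
      s' a_last = (if coef f (cell p) = 0 then s a_last else (s a_last)(f := p)) \<Longrightarrow> Q s'"
  shows "wp L find_last_step Q s"
proof -
  have p: "s a_in p = cell p" using s by (simp add: ready_def parsed_def)
  let ?X1 = "ext (X(cell p := 1))" and ?X0 = "ext (X(cell p := 0))"
  show ?thesis
    unfolding find_last_step_def wp.simps
    apply (rule wp_extend[where X = "X(cell p := 1)"])
      apply (use s in \<open>auto intro: ready_frame\<close>)[1]
     apply (use s p in \<open>simp add: bits_upd_1\<close>)
    apply (rule wp_parity[where f = f and X = ?X1])
         apply (rule ready_parsed, rule ready_frame[OF s(1)]; simp)
        apply simp
       apply (simp add: s)
      apply (simp add: s)
     apply simp
    apply (rule wp_extend[where X = "?X1(cell p := 0)"])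
      apply (rule ready_frame[OF s(1)]; simp)
     apply (simp add: s p bits_upd_0)
    apply (rule wp_parity[where f = f and X = ?X0])
         apply (rule ready_parsed, rule ready_frame[OF s(1)]; simp)
        apply (simp add: ext_upd_ext)
       apply (simp add: s)
      apply (simp add: s)
     apply simp
    subgoal premises prems for s1 s2 s3 s4
    proof -
      have eq: "s4 r_old 0 = nat_of_bit (val f (X(cell p := 1)))"
          "s4 r_acc 0 = nat_of_bit (val f (X(cell p := 0)))"
          "s4 a_last = s a_last" "s4 a_asg = bits ?X0" "s4 r_f = s r_f" "s4 r_p = s r_p"
        by (simp_all add: prems val_def ext_upd_ext)
      have fr: "\<forall>j. j \<notin> {r_e, a_asg, r_acc, r_v, r_old, a_last} \<longrightarrow> s4 j = s j"
        by (simp add: prems)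
      show ?thesis
      proof (cases "coef f (cell p) = 0")
        case True
        with coef_eq_0_iff[of f "cell p" X] show ?thesis
          using post[OF fr eq(4)] by (simp add: eq)
      next
        case False
        with coef_eq_0_iff[of f "cell p" X] fr eq(4)
        have "Q (s4(a_last := (s a_last)(f := p)))" by (intro post) auto
        moreover have "\<not> bval (Eq (Var r_old) (Var r_acc)) s4"
          using False coef_eq_0_iff[of f "cell p" X] unfolding bval_Eq by (simp add: eq)
        ultimately show ?thesis using s by (simp add: eq del: bval.simps)
      qed
    qed
    done
qed

text \<open>The maximum of the possibly empty set of positions between 1 and \<open>p - 1\<close>
  with nonzero coefficient, where 0 stands for the empty set.\<close>

definition last_ok :: "nat \<Rightarrow> (nat \<Rightarrow> nat) \<Rightarrow> nat \<Rightarrow> bool" where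
  "last_ok p l f \<longleftrightarrow> (l f = 0 \<or> l f < p \<and> coef f (cell (l f)) = 1) \<and>
     (\<forall>q. l f < q \<and> q < p \<longrightarrow> coef f (cell q) = 0)"

lemma wp_find_last:
  assumes s: "ready s" "s a_asg = bits X" "\<forall>f<m. s a_last f = 0"
    and post: "\<And>s' Y. \<forall>j. j \<notin> writes find_last \<longrightarrow> s' j = s j \<Longrightarrow>
      s' a_asg = bits Y \<Longrightarrow> \<forall>f<m. last_ok (Suc len) (s' a_last) f \<Longrightarrow> Q s'"
  shows "wp L find_last Q s"
  unfolding find_last_def
proof (rule wp_For[where lo = 1 and hi = "Suc len" and
      I = "\<lambda>p s'. (\<exists>X. s' a_asg = bits X) \<and> (\<forall>f<m. last_ok p (s' a_last) f)"])
  fix p s'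
  assume p: "1 \<le> p" "p < Suc len" "s' r_p 0 = p"
    and fr: "\<forall>j. j \<notin> insert r_p (writes (For r_f (Const 0) (Arr a_in (Const 2)) find_last_step)) \<longrightarrow>
      s' j = s j"
    and I: "(\<exists>X. s' a_asg = bits X) \<and> (\<forall>f<m. last_ok p (s' a_last) f)"
  have r: "ready s'" by (rule ready_frame[OF s(1)]; simp add: fr)
  show "wp L (For r_f (Const 0) (Arr a_in (Const 2)) find_last_step)
     (\<lambda>s'. (\<exists>X. s' a_asg = bits X) \<and> (\<forall>f<m. last_ok (Suc p) (s' a_last) f)) s'"
  proof (rule wp_For[where lo = 0 and hi = m and
        I = "\<lambda>n t. (\<exists>X. t a_asg = bits X) \<and>
          (\<forall>f<m. last_ok (if f < n then Suc p else p) (t a_last) f)"])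
    fix n t
    assume n: "n < m" "t r_f 0 = n"
      and frt: "\<forall>j. j \<notin> insert r_f (writes find_last_step) \<longrightarrow> t j = s' j"
      and It: "(\<exists>X. t a_asg = bits X) \<and> (\<forall>f<m. last_ok (if f < n then Suc p else p) (t a_last) f)"
    then obtain X where X: "t a_asg = bits X" by blast
    have rt: "ready t" by (rule ready_frame[OF r]; simp add: frt)
    show "wp L find_last_step (\<lambda>t. (\<exists>X. t a_asg = bits X) \<and>
      (\<forall>f<m. last_ok (if f < Suc n then Suc p else p) (t a_last) f)) t"
    proof (rule wp_find_last_step[OF rt X n(2,1)])
      show "t r_p 0 = p" using frt p by simp
      fix t' Y
      assume Y: "t' a_asg = bits Y"
        and l: "t' a_last = (if coef n (cell p) = 0 then t a_last else (t a_last)(n := p))"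
      have "last_ok (if f < Suc n then Suc p else p) (t' a_last) f" if "f < m" for f
      proof (cases "f = n")
        case True
        with It that have "last_ok p (t a_last) n" by auto
        with True l p show ?thesis by (auto simp: last_ok_def less_Suc_eq)
      next
        case False
        with It that l show ?thesis by (auto simp: last_ok_def less_Suc_eq)
      qed
      with Y show "(\<exists>X. t' a_asg = bits X) \<and>
        (\<forall>f<m. last_ok (if f < Suc n then Suc p else p) (t' a_last) f)" by blast
    qed
  next
    fix t assume "\<forall>j. j \<notin> insert r_f (writes find_last_step) \<longrightarrow> t j = s' j"
    then have "t a_in = s' a_in" by simp
    then show "aval (Arr a_in (Const 2)) t = m" using r by (simp add: ready_def parsed_def cell_2)
  qed (use I m_le in auto)
next
  fix s' assume "\<forall>j. j \<notin> insert r_p (writes (For r_f (Const 0) (Arr a_in (Const 2)) find_last_step)) \<longrightarrow>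
      s' j = s j"
  then have "s' a_in = s a_in" by simp
  then show "aval (Plus (Arr a_in (Const 0)) (Const 1)) s' = Suc len"
    using s by (simp add: ready_def parsed_def cell_0)
next
  fix s'
  assume "\<forall>j. j \<notin> insert r_p (writes (For r_f (Const 0) (Arr a_in (Const 2)) find_last_step)) \<longrightarrow>
      s' j = s j"
    "(\<exists>X. s' a_asg = bits X) \<and> (\<forall>f<m. last_ok (Suc len) (s' a_last) f)"
  then show "Q s'" by (auto intro!: post)
qed (use s len_le in \<open>auto simp: last_ok_def\<close>)

lemma wp_tally:
  assumes s: "ready s" "s a_asg = bits (ext X)" "s r_sat 0 = 0" "s r_unsat 0 = 0" "s r_p 0 = p"
    and post: "\<And>s'. \<forall>j. j \<notin> writes tally \<longrightarrow> s' j = s j \<Longrightarrow>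
      s' r_sat 0 = (\<Sum>f | f < m \<and> s a_last f = p \<and> val f X = b f. w f) \<Longrightarrow>
      s' r_unsat 0 = (\<Sum>f | f < m \<and> s a_last f = p \<and> val f X \<noteq> b f. w f) \<Longrightarrow> Q s'"
  shows "wp L tally Q s"
  unfolding tally_def
proof (rule wp_For[where lo = 0 and hi = m and I = "\<lambda>n s'.
      s' r_sat 0 = (\<Sum>f | f < n \<and> s a_last f = p \<and> val f X = b f. w f) \<and>
      s' r_unsat 0 = (\<Sum>f | f < n \<and> s a_last f = p \<and> val f X \<noteq> b f. w f)"])
  fix n s'
  assume n: "n < m" "s' r_f 0 = n" and fr: "\<forall>j. j \<notin> insert r_f (writes tally_step) \<longrightarrow> s' j = s j"
    and I: "s' r_sat 0 = (\<Sum>f | f < n \<and> s a_last f = p \<and> val f X = b f. w f) \<and>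
      s' r_unsat 0 = (\<Sum>f | f < n \<and> s a_last f = p \<and> val f X \<noteq> b f. w f)"
  have r: "ready s'" by (rule ready_frame[OF s(1)]; simp add: fr)
  have upd: "(\<Sum>f | f < Suc n \<and> P f. w f) = (\<Sum>f | f < n \<and> P f. w f) + (if P n then w n else 0)" for P
  proof -
    have "{f. f < Suc n \<and> P f} = (if P n then insert n {f. f < n \<and> P f} else {f. f < n \<and> P f})"
      by (auto simp: less_Suc_eq)
    then show ?thesis by simp
  qed
  show "wp L tally_step (\<lambda>s'.
      s' r_sat 0 = (\<Sum>f | f < Suc n \<and> s a_last f = p \<and> val f X = b f. w f) \<and>
      s' r_unsat 0 = (\<Sum>f | f < Suc n \<and> s a_last f = p \<and> val f X \<noteq> b f. w f)) s'"
  proof (cases "s a_last n = p")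
    case False
    with n fr I s show ?thesis
      unfolding upd by (auto simp: tally_step_def)
  next
    case True
    have "bval (Eq (Arr a_last (Var r_f)) (Var r_p)) s'"
      using True n fr s by simp
    moreover have "wp L (parity r_f) (wp L (Cond (Eq (Var r_acc) (eqn_rhs r_f))
               (Set r_sat (Plus (Var r_sat) (eqn_wt r_f)))
               (Set r_unsat (Plus (Var r_unsat) (eqn_wt r_f))))
      (\<lambda>s'. s' r_sat 0 = (\<Sum>f | f < Suc n \<and> s a_last f = p \<and> val f X = b f. w f) \<and>
      s' r_unsat 0 = (\<Sum>f | f < Suc n \<and> s a_last f = p \<and> val f X \<noteq> b f. w f))) s'"
    proof (rule wp_parity[where f = n and X = "ext X"])
      fix t assume t: "\<forall>j. j \<notin> {r_v, r_acc} \<longrightarrow> t j = s' j"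
        and acc: "t r_acc 0 = nat_of_bit (\<Sum>v\<in>V n. ext X v)"
      have "ready t" by (rule ready_frame[OF r]; simp add: t)
      then have "aval (eqn_rhs r_f) t = nat_of_bit (b n)" "aval (eqn_wt r_f) t = w n"
        using eqn_rhs_eq[of t r_f] eqn_wt_eq[of t r_f] n t by (auto dest: ready_parsed)
      then have "bval (Eq (Var r_acc) (eqn_rhs r_f)) t \<longleftrightarrow> val n X = b n" "aval (eqn_wt r_f) t = w n"
        unfolding bval_Eq by (auto simp: acc val_def)
      then show "wp L (Cond (Eq (Var r_acc) (eqn_rhs r_f))
               (Set r_sat (Plus (Var r_sat) (eqn_wt r_f)))
               (Set r_unsat (Plus (Var r_unsat) (eqn_wt r_f))))
      (\<lambda>s'. s' r_sat 0 = (\<Sum>f | f < Suc n \<and> s a_last f = p \<and> val f X = b f. w f) \<and>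
      s' r_unsat 0 = (\<Sum>f | f < Suc n \<and> s a_last f = p \<and> val f X \<noteq> b f. w f)) t"
        using I t True unfolding upd by (simp del: bval.simps)
    qed (use n r fr s in \<open>auto dest: ready_parsed\<close>)
    ultimately show ?thesis unfolding tally_step_def by (simp del: bval.simps wp.simps add: wp.simps(3,4))
  qed
next
  fix s' assume "\<forall>j. j \<notin> insert r_f (writes tally_step) \<longrightarrow> s' j = s j"
  then have "s' a_in = s a_in" by simp
  then show "aval (Arr a_in (Const 2)) s' = m" using s by (simp add: ready_def parsed_def cell_2)
qed (use s m_le post in auto)

lemma majority_cong: "(\<And>f. val f X = val f Y) \<Longrightarrow> majority u l p X \<longleftrightarrow> majority u l p Y"
  by (simp add: majority_def)

lemma wp_assign:
  assumes s: "ready s" "s a_asg = bits X" and l: "\<forall>f<m. last_ok (Suc len) (s a_last) f"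
    and post: "\<And>s' Y. \<forall>j. j \<notin> writes assign \<longrightarrow> s' j = s j \<Longrightarrow>
      s' a_asg = bits Y \<Longrightarrow> majority w (s a_last) (Suc len) Y \<Longrightarrow> Q s'"
  shows "wp L assign Q s"
  unfolding assign_def
proof (rule wp_For[where lo = 1 and hi = "Suc len" and
      I = "\<lambda>p s'. \<exists>X. s' a_asg = bits X \<and> majority w (s a_last) p X"])
  fix p s'
  assume p: "1 \<le> p" "p < Suc len" "s' r_p 0 = p"
    and fr: "\<forall>j. j \<notin> insert r_p (writes assign_step) \<longrightarrow> s' j = s j"
    and "\<exists>X. s' a_asg = bits X \<and> majority w (s a_last) p X"
  then obtain X where X: "s' a_asg = bits X" and maj: "majority w (s a_last) p X" by blast
  have r: "ready s'" by (rule ready_frame[OF s(1)]; simp add: fr)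
  have cp: "s' a_in p = cell p" using r by (simp add: ready_def parsed_def)
  let ?Y = "ext (X(cell p := 0))"
  define sat where "sat = (\<Sum>f | f < m \<and> s a_last f = p \<and> val f (X(cell p := 0)) = b f. w f)"
  define unsat where "unsat = (\<Sum>f | f < m \<and> s a_last f = p \<and> val f (X(cell p := 0)) \<noteq> b f. w f)"
  have maj': "majority w (s a_last) (Suc p) (X(cell p := (if sat < unsat then 1 else 0)))"
  proof (rule majority_step[OF maj _ _ _ sat_def unsat_def])
    show "coef f (cell p) = 1" if "f < m" "s a_last f = p" for f
      using l p that by (auto simp: last_ok_def)
    show "coef f (cell p) = 0" if "f < m" "0 < s a_last f" "s a_last f < p" for f
      using l p that by (auto simp: last_ok_def)
  qed (use p in simp)
  show "wp L assign_step (\<lambda>s'. \<exists>X. s' a_asg = bits X \<and> majority w (s a_last) (Suc p) X) s'"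
    unfolding assign_step_def wp.simps
    apply (rule wp_extend[where X = "X(cell p := 0)"])
      apply (rule ready_frame[OF r]; simp)
     apply (simp add: X p cp bits_upd_0)
    apply (rule wp_tally[where X = "X(cell p := 0)" and p = p])
         apply (rule ready_frame[OF r]; simp)
        apply simp
       apply simp
      apply simp
     apply (simp add: p)
    subgoal for s1 s2
    proof -
      assume 1: "\<forall>j. j \<notin> {r_e, a_asg, r_acc, r_v} \<longrightarrow>
          s1 j = (s'(a_asg := (s' a_asg)(aval (Arr a_in (Var r_p)) s' := aval (Const 0) s'))) j"
        "s1 a_asg = bits ?Y"
      let ?t = "s1(r_sat := (s1 r_sat)(aval (Const 0) s1 := aval (Const 0) s1))"
      let ?t = "?t(r_unsat := (?t r_unsat)(aval (Const 0) ?t := aval (Const 0) ?t))"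
      assume 2: "\<forall>j. j \<notin> writes tally \<longrightarrow> s2 j = ?t j"
        "s2 r_sat 0 = (\<Sum>f | f < m \<and> ?t a_last f = p \<and> val f (X(cell p := 0)) = b f. w f)"
        "s2 r_unsat 0 = (\<Sum>f | f < m \<and> ?t a_last f = p \<and> val f (X(cell p := 0)) \<noteq> b f. w f)"
      from 1 fr have "s1 a_last = s a_last" by simp
      with 2 have "s2 r_sat 0 = sat" "s2 r_unsat 0 = unsat" by (simp_all add: sat_def unsat_def)
      moreover have "s2 a_asg = bits ?Y" "s2 r_p 0 = p" "s2 a_in = s' a_in"
        using 1 2 p by simp_all
      \<comment> \<open>The program modifies the extended assignment, whereas \<open>maj'\<close>
        speaks about \<open>X\<close>. Both give the same \<open>val\<close>, which recomputes the
        pivots.\<close>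
      moreover have "majority w (s a_last) (Suc p) (if sat < unsat then ?Y(cell p := 1) else ?Y)"
        using maj' by (auto simp: val_upd_ext val_ext cong: majority_cong split: if_splits
            elim!: majority_cong[THEN iffD1, rotated])
      ultimately show ?thesis
        using cp by (auto simp: bits_upd_1 split: if_splits)
    qed
    done
next
  fix s' assume "\<forall>j. j \<notin> insert r_p (writes assign_step) \<longrightarrow> s' j = s j"
  then have "s' a_in = s a_in" by simp
  then show "aval (Plus (Arr a_in (Const 0)) (Const 1)) s' = Suc len"
    using s by (simp add: ready_def parsed_def cell_0)
next
  fix s'
  assume "\<forall>j. j \<notin> insert r_p (writes assign_step) \<longrightarrow> s' j = s j"
    "\<exists>X. s' a_asg = bits X \<and> majority w (s a_last) (Suc len) X"
  then show "Q s'" by (auto intro!: post)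
next
  have "{f. f < m \<and> 0 < s a_last f \<and> s a_last f < 1} = {}" by auto
  then have "majority w (s a_last) 1 X" unfolding majority_def by (simp only: sum.empty le0)
  then show "\<exists>X. s a_asg = bits X \<and> majority w (s a_last) 1 X" using s by blast
qed (use len_le in auto)

end

text \<open>The extension before \<open>emit\<close> is needed because the last choices in
  \<open>assign\<close> may leave pivots out of date.\<close>

definition solve :: com where
  "solve = Seq find_last (Seq assign (Seq extend emit))"

section \<open>Output and its weight\<close>

context lin_instance
begin

lemma set_output_list: "set (output_list s) = (\<lambda>i. s a_out (i + 1)) ` {..<s a_out 0}"
  by (simp add: output_list_def atLeast0LessThan)

lemma length_output_list: "length (output_list s) = s a_out 0"
  by (simp add: output_list_def)

lemma wp_emit:
  assumes s: "parsed s" "s a_asg = bits X" "s a_out 0 = 0"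
    and post: "\<And>s'. set (output_list s') = {cell q |q. 0 < q \<and> q \<le> len \<and> X (cell q) = 1} \<Longrightarrow>
      length (output_list s') \<le> len \<Longrightarrow> Q s'"
  shows "wp L emit Q s"
proof -
  define R where "R p = {cell q |q. 0 < q \<and> q < p \<and> X (cell q) = 1}" for p
  define written where "written g = (\<lambda>i. g (i + 1)) ` {..<g (0::nat)}" for g :: "nat \<Rightarrow> nat"
  have R_1: "R 1 = {}" by (auto simp: R_def)
  have R_Suc: "R (Suc p) = (if X (cell p) = 1 then insert (cell p) (R p) else R p)" if "1 \<le> p" for p
    using that by (auto simp: R_def less_Suc_eq)
  have written_0: "written g = {}" if "g 0 = 0" for g
    using that by (simp add: written_def)
  have written_Suc: "written (g(Suc (g 0) := v, 0 := Suc (g 0))) = insert v (written g)" for g v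
  proof -
    have "(\<lambda>i. (g(Suc (g 0) := v, 0 := Suc (g 0))) (i + 1)) ` {..<g 0} = (\<lambda>i. g (i + 1)) ` {..<g 0}"
      by (intro image_cong) auto
    then show ?thesis unfolding written_def fun_upd_same lessThan_Suc image_insert by simp
  qed
  let ?P = "Cond (Less (Const 0) (Arr a_asg (Arr a_in (Var r_p))))
        (Seq (Store a_out (Plus (Var a_out) (Const 1)) (Arr a_in (Var r_p)))
             (Set a_out (Plus (Var a_out) (Const 1))))
        Skip"
  show ?thesis
    unfolding emit_def
  \<comment> \<open>The strict bound by \<open>p\<close> says at most one output entry per cell
    read, which limits the length of the output to \<open>len\<close>.\<close>
  proof (rule wp_For[where lo = 1 and hi = "Suc len" and
        I = "\<lambda>p s'. s' a_out 0 < p \<and> written (s' a_out) = R p"])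
    fix p s'
    assume p: "1 \<le> p" "s' r_p 0 = p" and I: "s' a_out 0 < p \<and> written (s' a_out) = R p"
      and fr: "\<forall>j. j \<notin> insert r_p (writes ?P) \<longrightarrow> s' j = s j"
    have "s' a_asg = bits X" "s' a_in p = cell p"
      using fr s by (simp_all add: parsed_def)
    with p I R_Suc[of p] show "wp L ?P (\<lambda>s'. s' a_out 0 < Suc p \<and> written (s' a_out) = R (Suc p)) s'"
      by (simp add: bits_def nat_of_bit_def written_Suc)
  next
    fix s' assume "\<forall>j. j \<notin> insert r_p (writes ?P) \<longrightarrow> s' j = s j"
    then have "s' a_in = s a_in" by simp
    then show "aval (Plus (Arr a_in (Const 0)) (Const 1)) s' = Suc len"
      using s by (simp add: parsed_def cell_0)
  next
    fix s' assume I: "s' a_out 0 < Suc len \<and> written (s' a_out) = R (Suc len)"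
    show "Q s'"
    proof (rule post)
      show "set (output_list s') = {cell q |q. 0 < q \<and> q \<le> len \<and> X (cell q) = 1}"
        using I unfolding set_output_list written_def R_def less_Suc_eq_le by (rule conjunct2)
      show "length (output_list s') \<le> len"
        using conjunct1[OF I] unfolding length_output_list by (rule less_Suc_eq_le[THEN iffD1])
    qed
  next
    show "s a_out 0 < 1 \<and> written (s a_out) = R 1"
      using s(3) written_0[of "s a_out"] R_1 by simp
  qed (use len_le in simp_all)
qed

lemma assignment_weight_eq:
  "assignment_weight F x = (\<Sum>f | f < m \<and> satisfies x (F ! f). w f)"
proof -
  have "assignment_weight F x = (\<Sum>f<m. if satisfies x (F ! f) then w f else 0)"
    by (simp add: assignment_weight_def sum_list_sum_nth atLeast0LessThan)
  also have "\<dots> = (\<Sum>f | f < m \<and> satisfies x (F ! f). w f)"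
    using sum.inter_filter[of "{..<m}" w "\<lambda>f. satisfies x (F ! f)"] by simp
  finally show ?thesis .
qed

lemma total_weight_eq: "total_weight F = (\<Sum>f<m. w f)"
  by (simp add: total_weight_def sum_list_sum_nth atLeast0LessThan)

end

context lin_selection
begin

text \<open>The decoded output needs to agree with \<open>ext X\<close> only on variables of the
  system, and each of them occurs in some cell. Selected equations have all coefficients 0, hence
  last position 0, as \<open>majority_final\<close> requires.\<close>

lemma above_average_decode:
  assumes l: "\<forall>f<m. last_ok (Suc len) l f" and maj: "majority w l (Suc len) X"
    and k: "k \<le> card {e. e < m \<and> lev e = J}"
    and ys: "set ys = {cell q |q. 0 < q \<and> q \<le> len \<and> ext X (cell q) = 1}"
  shows "above_average F k (decode_assignment ys)"
proof -
  have "decode_assignment ys v = ext X v" if "f < m" "v \<in> V f" for f v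
    using var_cell[OF that] ys bit_cases_01[of "ext X v"] by (auto simp: decode_assignment_def)
  then have "(\<Sum>v\<in>V f. decode_assignment ys v) = val f X" if "f < m" for f
    using that by (simp add: val_def)
  then have sat: "{f. f < m \<and> satisfies (decode_assignment ys) (F ! f)} = {f. f < m \<and> val f X = b f}"
    by (auto simp: satisfies_def)
  have "(\<Sum>f<m. w f) + card {e. e < m \<and> lev e = J} \<le> 2 * (\<Sum>f | f < m \<and> val f X = b f. w f)"
  proof (rule majority_final[OF maj w_pos])
    show "l f < Suc len" if "f < m" for f
      using l that by (auto simp: last_ok_def)
    show "coef f v = 0" if "f < m" "l f = 0" "g < m" "v \<in> V g" for f g v
      using l that var_cell[OF that(3,4)] by (auto simp: last_ok_def)
    show "l e = 0" if "e \<in> {e. e < m \<and> lev e = J}" for e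
    proof (rule ccontr)
      assume "l e \<noteq> 0"
      with l that have "coef e (cell (l e)) = 1" by (auto simp: last_ok_def)
      with coef_selected[OF that] show False by simp
    qed
  qed
  with k have "total_weight F + k \<le> 2 * assignment_weight F (decode_assignment ys)"
    by (simp add: assignment_weight_eq total_weight_eq sat)
  then have "real (total_weight F + k) \<le> real (2 * assignment_weight F (decode_assignment ys))"
    by (simp only: of_nat_le_iff)
  then show ?thesis by (simp add: above_average_def)
qed

lemma wp_solve:
  assumes s: "ready s" "s a_asg = bits X" "\<forall>f<m. s a_last f = 0" "s a_out 0 = 0"
    and k: "k \<le> card {e. e < m \<and> lev e = J}"
  shows "wp L solve (\<lambda>s'. above_average F k (decode_assignment (output_list s')) \<and>
    length (output_list s') \<le> len) s" (is "wp L _ ?Q s")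
proof -
  have "wp L find_last (wp L assign (wp L extend (wp L emit ?Q))) s"
  proof (rule wp_find_last[OF s(1-3)])
    fix s1 X1
    assume s1: "\<forall>j. j \<notin> writes find_last \<longrightarrow> s1 j = s j" "s1 a_asg = bits X1"
      "\<forall>f<m. last_ok (Suc len) (s1 a_last) f"
    have r1: "ready s1" by (rule ready_frame[OF s(1)]; simp add: s1(1))
    show "wp L assign (wp L extend (wp L emit ?Q)) s1"
    proof (rule wp_assign[OF r1 s1(2,3)])
      fix s2 X2
      assume s2: "\<forall>j. j \<notin> writes assign \<longrightarrow> s2 j = s1 j" "s2 a_asg = bits X2"
        "majority w (s1 a_last) (Suc len) X2"
      have r2: "ready s2" by (rule ready_frame[OF r1]; simp add: s2(1))
      show "wp L extend (wp L emit ?Q) s2"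
      proof (rule wp_extend[OF r2 s2(2)])
        fix s3
        assume s3: "\<forall>j. j \<notin> {r_e, a_asg, r_acc, r_v} \<longrightarrow> s3 j = s2 j" "s3 a_asg = bits (ext X2)"
        have r3: "ready s3" by (rule ready_frame[OF r2]; simp add: s3(1))
        have "s3 a_out = s a_out" by (simp add: s1(1) s2(1) s3(1))
        with s(4) have out: "s3 a_out 0 = 0" by (simp only:)
        show "wp L emit ?Q s3"
        proof (rule wp_emit[OF ready_parsed[OF r3] s3(2) out], rule conjI)
          fix s'
          assume "set (output_list s') = {cell q |q. 0 < q \<and> q \<le> len \<and> ext X2 (cell q) = 1}"
          then show "above_average F k (decode_assignment (output_list s'))"
            by (rule above_average_decode[OF s1(3) s2(3) k])
        qed
      qed
    qed
  qed
  then show ?thesis by (simp only: solve_def wp.simps)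
qed

end

section \<open>Greedy selection of a level\<close>

definition count_uncovered :: com where
  "count_uncovered = Seq (Set r_cnt (Const 0))
     (for_eqn r_e (Set r_cnt (Plus (Var r_cnt) (Minus (Const 1) (Arr a_cov cur_var)))))"

text \<open>Overwriting leaves the last newly covered variable as pivot; any variable of the block
  would serve.\<close>

definition cover :: com where
  "cover = for_eqn r_e
     (Cond (Less (Arr a_cov cur_var) (Const 1))
        (Seq (Store a_piv (Var r_e) cur_var) (Store a_cov cur_var (Const 1))) Skip)"

definition cover_step :: "nat \<Rightarrow> com" where
  "cover_step c =
     Seq count_uncovered
         (Cond (Eq (Var r_cnt) (Minus (Const c) (Var r_j)))
            (Seq cover (Store a_lev (Var r_e) (Minus (Const c) (Var r_j)))) Skip)"

text \<open>Loops only count upwards, so the counter value \<open>j\<close> stands for level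
  \<open>c - j\<close>, running from \<open>c\<close> down to 1.\<close>

definition greedy :: "nat \<Rightarrow> com" where
  "greedy c = For r_j (Const 0) (Const c) (For r_e (Const 0) (Arr a_in (Const 2)) (cover_step c))"

definition count_level :: com where
  "count_level = Seq (Set r_cnt (Const 0))
     (For r_e (Const 0) (Arr a_in (Const 2))
        (Cond (Eq (Arr a_lev (Var r_e)) (Var r_j)) (Set r_cnt (Plus (Var r_cnt) (Const 1))) Skip))"

text \<open>Overwriting keeps the largest level with at least \<open>k\<close> equations.\<close>

definition select :: "nat \<Rightarrow> com" where
  "select c = For r_j (Const 1) (Const (Suc c))
     (Seq count_level
          (Cond (Less (Var r_cnt) (Arr a_in (Const 1))) Skip (Set r_sel (Var r_j))))"

lemma writes_count_uncovered [simp]: "writes count_uncovered = {r_cnt, r_v}"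
  by (auto simp: count_uncovered_def)

lemma writes_cover [simp]: "writes cover = {r_v, a_piv, a_cov}"
  by (auto simp: cover_def)

lemma writes_cover_step [simp]: "writes (cover_step c) = {r_cnt, r_v, a_piv, a_cov, a_lev}"
  by (auto simp: cover_step_def)

lemma writes_greedy [simp]: "writes (greedy c) = {r_j, r_e, r_cnt, r_v, a_piv, a_cov, a_lev}"
  by (auto simp: greedy_def)

lemma writes_count_level [simp]: "writes count_level = {r_cnt, r_e}"
  by (auto simp: count_level_def)

lemma writes_select [simp]: "writes (select c) = {r_j, r_e, r_cnt, r_sel}"
  by (auto simp: select_def)

section \<open>Invariants of the greedy covering\<close>

context lin_instance
begin

text \<open>\<open>lev e\<close> is the level at which equation \<open>e\<close> was picked, or \<open>0\<close> if it was not.\<close>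

definition block :: "nat \<Rightarrow> (nat \<Rightarrow> nat) \<Rightarrow> (nat \<Rightarrow> nat) \<Rightarrow> nat set \<Rightarrow> bool" where
  "block J lev piv A \<longleftrightarrow>
     (\<forall>f<m. card (V f - A) \<le> J) \<and>
     (\<forall>e<m. lev e = J \<longrightarrow> card (V e - A) = J \<and> piv e \<in> V e - A) \<and>
     (\<forall>e<m. \<forall>e'<m. lev e = J \<longrightarrow> lev e' = J \<longrightarrow> e \<noteq> e' \<longrightarrow> (V e - A) \<inter> (V e' - A) = {})"

text \<open>Each level above \<open>j\<close> has its own witness \<open>A\<close>. An equation
  picked at level \<open>J\<close> adds exactly \<open>J\<close> variables and one not picked has
  level 0, so the levels sum up to the size of the covered set.\<close>

definition covered :: "nat \<Rightarrow> nat set \<Rightarrow> (nat \<Rightarrow> nat) \<Rightarrow> (nat \<Rightarrow> nat) \<Rightarrow> bool" where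
  "covered j C lev piv \<longleftrightarrow>
     (\<forall>J. j < J \<and> J \<le> c \<longrightarrow> (\<exists>A. block J lev piv A)) \<and>
     (\<forall>e<m. lev e \<noteq> 0 \<longrightarrow> j < lev e \<and> lev e \<le> c \<and> V e \<subseteq> C) \<and>
     finite C \<and> card C = (\<Sum>e<m. lev e)"

text \<open>\<open>V e\<close> has at most \<open>Suc j\<close> variables outside \<open>A\<close>
  and exactly \<open>Suc j\<close> outside the larger set \<open>C\<close>, so both differences
  coincide. The block of \<open>e\<close> relative to \<open>A\<close> thus avoids everything
  covered since, in particular the blocks picked earlier at this level.\<close>

lemma covered_update:
  assumes cov: "covered j C lev piv" and bl: "block (Suc j) lev piv A" and A: "A \<subseteq> C"
    and e: "e < m" "card (V e - C) = Suc j" and j: "Suc j \<le> c" and v: "v \<in> V e - C"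
  shows "covered j (C \<union> V e) (lev(e := Suc j)) (piv(e := v))"
    and "block (Suc j) (lev(e := Suc j)) (piv(e := v)) A"
proof -
  have lev_e: "lev e = 0" using cov e v by (auto simp: covered_def)
  have "card (V e - A) \<le> Suc j" using bl e by (auto simp: block_def)
  then have eq: "V e - A = V e - C"
    using A e finV[of e] by (intro card_seteq[symmetric]) auto
  have sep: "(V e - A) \<inter> (V g - A) = {}" if "g < m" "lev g = Suc j" for g
    unfolding eq using cov that by (auto simp: covered_def)
  show bl': "block (Suc j) (lev(e := Suc j)) (piv(e := v)) A"
    unfolding block_def
  proof (intro conjI allI impI)
    fix g g' assume g: "g < m" "g' < m" "(lev(e := Suc j)) g = Suc j" "(lev(e := Suc j)) g' = Suc j" "g \<noteq> g'"
    show "(V g - A) \<inter> (V g' - A) = {}"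
    proof (cases "g = e \<or> g' = e")
      case True
      with g sep[of g] sep[of g'] show ?thesis by (auto simp: Int_commute split: if_splits)
    next
      case False
      with g bl show ?thesis unfolding block_def by auto
    qed
  qed (use bl e v eq in \<open>auto simp: block_def split: if_splits\<close>)
  have "\<exists>A. block J (lev(e := Suc j)) (piv(e := v)) A" if J: "j < J" "J \<le> c" for J
  proof (cases "J = Suc j")
    case True
    with bl' show ?thesis by blast
  next
    case False
    from cov J obtain A' where "block J lev piv A'" by (auto simp: covered_def)
    with False J lev_e have "block J (lev(e := Suc j)) (piv(e := v)) A'"
      unfolding block_def by auto
    then show ?thesis by blast
  qed
  moreover have "card (C \<union> V e) = card C + Suc j"
  proof -
    have "card (C \<union> V e) = card (C \<union> (V e - C))" by simp
    also have "\<dots> = card C + card (V e - C)"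
      using cov finV[of e] e by (intro card_Un_disjoint) (auto simp: covered_def)
    finally show ?thesis using e by simp
  qed
  moreover have "(\<Sum>g<m. (lev(e := Suc j)) g) = (\<Sum>g<m. lev g) + Suc j"
    using e lev_e by (simp add: sum.remove[of "{..<m}" e])
  ultimately show "covered j (C \<union> V e) (lev(e := Suc j)) (piv(e := v))"
    using cov e j finV[of e] by (auto simp: covered_def split: if_splits)
qed

text \<open>When a level begins, no equation carries it yet; only the size bound in
  \<open>block\<close> is not vacuous.\<close>

lemma covered_block_step:
  assumes "covered (Suc j) C lev piv" "\<forall>f<m. card (V f - C) \<le> Suc j"
  shows "block (Suc j) lev piv C" "covered j C lev piv"
proof -
  have "lev e \<noteq> Suc j" if "e < m" for e
    using assms(1) that by (auto simp: covered_def)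
  then show bl: "block (Suc j) lev piv C" using assms(2) by (auto simp: block_def)
  have "\<exists>A. block J lev piv A" if "j < J" "J \<le> c" for J
    using assms(1) bl that by (cases "J = Suc j") (auto simp: covered_def)
  with assms(1) show "covered j C lev piv" by (fastforce simp: covered_def)
qed

lemma wp_count_uncovered:
  assumes s: "parsed s" "s a_cov = (\<lambda>v. of_bool (v \<in> C))" "s r_e 0 = e" "e < m"
    and post: "\<And>s'. \<forall>j. j \<notin> {r_cnt, r_v} \<longrightarrow> s' j = s j \<Longrightarrow> s' r_cnt 0 = card (V e - C) \<Longrightarrow> Q s'"
  shows "wp L count_uncovered Q s"
  unfolding count_uncovered_def wp.simps
proof (rule wp_for_eqn[where f = e and I = "\<lambda>U s'. s' r_cnt 0 = card (U - C)"])
  let ?P = "Set r_cnt (Plus (Var r_cnt) (Minus (Const 1) (Arr a_cov cur_var)))"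
  {
    fix U v s'
    assume U: "U \<subseteq> V e" "v \<in> V e" "v \<notin> U" "s' a_in (s' r_v 0) = v" "s' r_cnt 0 = card (U - C)"
      and fr: "\<forall>j. j \<notin> insert r_v (writes ?P) \<longrightarrow>
        s' j = (s(r_cnt := (s r_cnt)(aval (Const 0) s := aval (Const 0) s))) j"
    have "finite U" using U finV[OF s(4)] finite_subset by blast
    moreover have "s' a_cov = (\<lambda>v. of_bool (v \<in> C))" using fr s by simp
    ultimately show "wp L ?P (\<lambda>s'. s' r_cnt 0 = card (insert v U - C)) s'"
      using U by (cases "v \<in> C") (simp_all add: insert_Diff_if)
  next
    fix s'
    assume "\<forall>j. j \<notin> insert r_v (writes ?P) \<longrightarrow>
        s' j = (s(r_cnt := (s r_cnt)(aval (Const 0) s := aval (Const 0) s))) j"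
      "s' r_cnt 0 = card (V e - C)"
    then show "Q s'" by (intro post) auto
  }
qed (use s in \<open>auto simp: parsed_def\<close>)

lemma wp_cover:
  assumes s: "parsed s" "s a_cov = (\<lambda>v. of_bool (v \<in> C))" "s r_e 0 = e" "e < m"
    and ne: "V e - C \<noteq> {}"
    and post: "\<And>s' v. \<forall>j. j \<notin> {r_v, a_piv, a_cov} \<longrightarrow> s' j = s j \<Longrightarrow>
      s' a_cov = (\<lambda>v. of_bool (v \<in> C \<union> V e)) \<Longrightarrow> v \<in> V e - C \<Longrightarrow> s' a_piv = (s a_piv)(e := v) \<Longrightarrow> Q s'"
  shows "wp L cover Q s"
  unfolding cover_def
proof (rule wp_for_eqn[where f = e and I = "\<lambda>U s'. s' a_cov = (\<lambda>v. of_bool (v \<in> C \<union> U)) \<and>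
      (U - C = {} \<or> (\<exists>v\<in>U - C. s' a_piv = (s a_piv)(e := v))) \<and>
      (U - C = {} \<longrightarrow> s' a_piv = s a_piv)"])
  let ?P = "Cond (Less (Arr a_cov cur_var) (Const 1))
        (Seq (Store a_piv (Var r_e) cur_var) (Store a_cov cur_var (Const 1))) Skip"
  {
    fix U v s'
    assume U: "v \<notin> U" "s' a_in (s' r_v 0) = v"
      and I: "s' a_cov = (\<lambda>v. of_bool (v \<in> C \<union> U)) \<and>
        (U - C = {} \<or> (\<exists>v\<in>U - C. s' a_piv = (s a_piv)(e := v))) \<and>
        (U - C = {} \<longrightarrow> s' a_piv = s a_piv)"
      and fr: "\<forall>j. j \<notin> insert r_v (writes ?P) \<longrightarrow> s' j = s j"
    have e: "s' r_e 0 = e" using fr s by simp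
    show "wp L ?P (\<lambda>s'. s' a_cov = (\<lambda>u. of_bool (u \<in> C \<union> insert v U)) \<and>
      (insert v U - C = {} \<or> (\<exists>u\<in>insert v U - C. s' a_piv = (s a_piv)(e := u))) \<and>
      (insert v U - C = {} \<longrightarrow> s' a_piv = s a_piv)) s'"
    proof (cases "v \<in> C")
      case True
      then have "C \<union> insert v U = C \<union> U" "insert v U - C = U - C" by auto
      with True I U show ?thesis by simp
    next
      case False
      have "(s' a_piv)(e := v) = (s a_piv)(e := v)" using I by auto
      moreover have "(s' a_cov)(v := Suc 0) = (\<lambda>u. of_bool (u \<in> C \<union> insert v U))"
        using I by (auto simp: fun_eq_iff)
      ultimately show ?thesis using False I U e by auto
    qed
  next
    fix s'
    assume "\<forall>j. j \<notin> insert r_v (writes ?P) \<longrightarrow> s' j = s j"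
      "s' a_cov = (\<lambda>v. of_bool (v \<in> C \<union> V e)) \<and>
        (V e - C = {} \<or> (\<exists>v\<in>V e - C. s' a_piv = (s a_piv)(e := v))) \<and>
        (V e - C = {} \<longrightarrow> s' a_piv = s a_piv)"
    then show "Q s'" using ne post by auto
  }
qed (use s in auto)

lemma wp_cover_step:
  assumes s: "parsed s" "s a_cov = (\<lambda>v. of_bool (v \<in> C))" "s r_e 0 = e" "e < m"
      "Suc j = c - s r_j 0"
    and skip: "\<And>s'. \<forall>i. i \<notin> {r_cnt, r_v} \<longrightarrow> s' i = s i \<Longrightarrow> card (V e - C) \<noteq> Suc j \<Longrightarrow> Q s'"
    and upd: "\<And>s' v. \<forall>i. i \<notin> {r_cnt, r_v, a_piv, a_cov, a_lev} \<longrightarrow> s' i = s i \<Longrightarrow>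
      card (V e - C) = Suc j \<Longrightarrow> v \<in> V e - C \<Longrightarrow>
      s' a_cov = (\<lambda>v. of_bool (v \<in> C \<union> V e)) \<Longrightarrow> s' a_piv = (s a_piv)(e := v) \<Longrightarrow>
      s' a_lev = (s a_lev)(e := Suc j) \<Longrightarrow> Q s'"
  shows "wp L (cover_step c) Q s"
  unfolding cover_step_def wp.simps
  apply (rule wp_count_uncovered[OF s(1-4)])
  subgoal premises p1 for s1
  proof (cases "card (V e - C) = Suc j")
    case False
    then have "\<not> bval (Eq (Var r_cnt) (Minus (Const c) (Var r_j))) s1"
      unfolding bval_Eq using p1 s(5) by simp
    with skip[OF p1(1) False] show ?thesis by (simp del: bval.simps)
  next
    case True
    then have ne: "V e - C \<noteq> {}" by force
    have "bval (Eq (Var r_cnt) (Minus (Const c) (Var r_j))) s1"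
      unfolding bval_Eq using p1 s(5) True by simp
    moreover have "wp L cover (\<lambda>s. Q (s(a_lev := (s a_lev)(s r_e 0 := c - s r_j 0)))) s1"
    proof (rule wp_cover[OF _ _ _ s(4) ne])
      show "parsed s1" using p1 s(1) by (simp add: parsed_def)
      show "s1 a_cov = (\<lambda>v. of_bool (v \<in> C))" "s1 r_e 0 = e" using p1 s by simp_all
      fix s2 v
      assume p2: "\<forall>j. j \<notin> {r_v, a_piv, a_cov} \<longrightarrow> s2 j = s1 j"
        "s2 a_cov = (\<lambda>v. of_bool (v \<in> C \<union> V e))" "v \<in> V e - C" "s2 a_piv = (s1 a_piv)(e := v)"
      show "Q (s2(a_lev := (s2 a_lev)(s2 r_e 0 := c - s2 r_j 0)))"
        using True s(5) by (intro upd[where v = v]) (use p1 p2 s in simp_all)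
    qed
    ultimately show ?thesis by (simp del: bval.simps)
  qed
  done

text \<open>One scan per level suffices: numbers of uncovered variables never grow, so an equation
  left with at most \<open>j\<close> of them stays so. In the inner invariant \<open>A\<close> is
  frozen at the start of the level while \<open>C\<close> grows.\<close>

lemma wp_greedy:
  assumes s: "parsed s" "s a_cov = (\<lambda>v. 0)" "s a_lev = (\<lambda>e. 0)"
    and post: "\<And>s' C. \<forall>i. i \<notin> writes (greedy c) \<longrightarrow> s' i = s i \<Longrightarrow>
      covered 0 C (s' a_lev) (s' a_piv) \<Longrightarrow> \<forall>f<m. V f \<subseteq> C \<Longrightarrow> Q s'"
  shows "wp L (greedy c) Q s"
  unfolding greedy_def
proof (rule wp_For[where lo = 0 and hi = c and I = "\<lambda>j s'. \<exists>C. s' a_cov = (\<lambda>v. of_bool (v \<in> C)) \<and>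
      covered (c - j) C (s' a_lev) (s' a_piv) \<and> (\<forall>f<m. card (V f - C) \<le> c - j)"])
  let ?P = "For r_e (Const 0) (Arr a_in (Const 2)) (cover_step c)"
  {
    fix n s'
    assume n: "n < c" "s' r_j 0 = n" and fr: "\<forall>j. j \<notin> insert r_j (writes ?P) \<longrightarrow> s' j = s j"
      and "\<exists>C. s' a_cov = (\<lambda>v. of_bool (v \<in> C)) \<and> covered (c - n) C (s' a_lev) (s' a_piv) \<and>
        (\<forall>f<m. card (V f - C) \<le> c - n)"
    then obtain A where A: "s' a_cov = (\<lambda>v. of_bool (v \<in> A))" "covered (c - n) A (s' a_lev) (s' a_piv)"
      "\<forall>f<m. card (V f - A) \<le> c - n" by blast
    define j where "j = c - Suc n"
    have j: "c - n = Suc j" "Suc j \<le> c" using n by (simp_all add: j_def)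
    have par: "parsed s'" using fr s by (simp add: parsed_def)
    show "wp L ?P (\<lambda>s'. \<exists>C. s' a_cov = (\<lambda>v. of_bool (v \<in> C)) \<and>
      covered (c - Suc n) C (s' a_lev) (s' a_piv) \<and> (\<forall>f<m. card (V f - C) \<le> c - Suc n)) s'"
    proof (rule wp_For[where lo = 0 and hi = m and I = "\<lambda>e t. \<exists>C. t a_cov = (\<lambda>v. of_bool (v \<in> C)) \<and>
        A \<subseteq> C \<and> covered j C (t a_lev) (t a_piv) \<and> block (Suc j) (t a_lev) (t a_piv) A \<and>
        (\<forall>f<e. card (V f - C) \<le> j)"])
      fix e t
      assume e: "e < m" "t r_e 0 = e" and frt: "\<forall>j. j \<notin> insert r_e (writes (cover_step c)) \<longrightarrow> t j = s' j"
        and "\<exists>C. t a_cov = (\<lambda>v. of_bool (v \<in> C)) \<and>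
          A \<subseteq> C \<and> covered j C (t a_lev) (t a_piv) \<and> block (Suc j) (t a_lev) (t a_piv) A \<and>
          (\<forall>f<e. card (V f - C) \<le> j)"
      then obtain C where C: "t a_cov = (\<lambda>v. of_bool (v \<in> C))" "A \<subseteq> C"
          "covered j C (t a_lev) (t a_piv)" "block (Suc j) (t a_lev) (t a_piv) A"
          "\<forall>f<e. card (V f - C) \<le> j" by blast
      show "wp L (cover_step c) (\<lambda>t. \<exists>C. t a_cov = (\<lambda>v. of_bool (v \<in> C)) \<and>
          A \<subseteq> C \<and> covered j C (t a_lev) (t a_piv) \<and> block (Suc j) (t a_lev) (t a_piv) A \<and>
          (\<forall>f<Suc e. card (V f - C) \<le> j)) t"
      proof (rule wp_cover_step[OF _ C(1) e(2,1)])
        show "parsed t" using frt par by (simp add: parsed_def)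
        show "Suc j = c - t r_j 0" using frt n j by simp
      next
        fix t'
        assume t': "\<forall>i. i \<notin> {r_cnt, r_v} \<longrightarrow> t' i = t i" "card (V e - C) \<noteq> Suc j"
        \<comment> \<open>A rejected equation had at most \<open>Suc j\<close> variables uncovered
          when the level began and does not have exactly \<open>Suc j\<close> now, so at most
          \<open>j\<close> remain.\<close>
        have "card (V e - C) \<le> card (V e - A)"
          using C(2) finV[OF e(1)] by (intro card_mono) auto
        moreover have "card (V e - A) \<le> Suc j" using C(4) e by (simp add: block_def)
        ultimately have "\<forall>f<Suc e. card (V f - C) \<le> j"
          using t'(2) C(5) by (auto simp: less_Suc_eq)
        with C t' show "\<exists>C. t' a_cov = (\<lambda>v. of_bool (v \<in> C)) \<and>
          A \<subseteq> C \<and> covered j C (t' a_lev) (t' a_piv) \<and> block (Suc j) (t' a_lev) (t' a_piv) A \<and>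
          (\<forall>f<Suc e. card (V f - C) \<le> j)" by (intro exI[of _ C]) simp
      next
        fix t' v
        assume t': "card (V e - C) = Suc j" "v \<in> V e - C" "t' a_cov = (\<lambda>v. of_bool (v \<in> C \<union> V e))"
          "t' a_piv = (t a_piv)(e := v)" "t' a_lev = (t a_lev)(e := Suc j)"
        have "card (V f - (C \<union> V e)) \<le> j" if "f < Suc e" for f
        proof (cases "f = e")
          case True
          then show ?thesis by (simp add: Diff_eq_empty_iff[THEN iffD2])
        next
          case False
          with that have "f < e" by simp
          have "card (V f - (C \<union> V e)) \<le> card (V f - C)"
            using finV[of f] e \<open>f < e\<close> by (intro card_mono) auto
          with C(5) \<open>f < e\<close> show ?thesis by fastforce
        qed
        with covered_update[OF C(3,4,2) e(1) t'(1) j(2) t'(2)] t' C(2)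
        show "\<exists>C. t' a_cov = (\<lambda>v. of_bool (v \<in> C)) \<and>
          A \<subseteq> C \<and> covered j C (t' a_lev) (t' a_piv) \<and> block (Suc j) (t' a_lev) (t' a_piv) A \<and>
          (\<forall>f<Suc e. card (V f - C) \<le> j)" by (intro exI[of _ "C \<union> V e"]) auto
      qed
    next
      show "\<exists>C. s' a_cov = (\<lambda>v. of_bool (v \<in> C)) \<and>
        A \<subseteq> C \<and> covered j C (s' a_lev) (s' a_piv) \<and> block (Suc j) (s' a_lev) (s' a_piv) A \<and>
        (\<forall>f<0. card (V f - C) \<le> j)"
        using A covered_block_step[of j A "s' a_lev" "s' a_piv"] j by (intro exI[of _ A]) auto
    next
      fix t assume "\<forall>j. j \<notin> insert r_e (writes (cover_step c)) \<longrightarrow> t j = s' j"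
      then have "t a_in = s' a_in" by simp
      then show "aval (Arr a_in (Const 2)) t = m" using par by (simp add: parsed_def cell_2)
    qed (use m_le in \<open>auto simp: j_def\<close>)
  next
    fix s'
    assume fr: "\<forall>j. j \<notin> insert r_j (writes ?P) \<longrightarrow> s' j = s j"
      and "\<exists>C. s' a_cov = (\<lambda>v. of_bool (v \<in> C)) \<and> covered (c - c) C (s' a_lev) (s' a_piv) \<and>
        (\<forall>f<m. card (V f - C) \<le> c - c)"
    then obtain C where C: "covered 0 C (s' a_lev) (s' a_piv)" "\<forall>f<m. card (V f - C) = 0" by auto
    then have "\<forall>f<m. V f \<subseteq> C" using finV by auto
    with C fr show "Q s'" by (intro post[where C = C]) auto
  next
    show "\<exists>C. s a_cov = (\<lambda>v. of_bool (v \<in> C)) \<and> covered (c - 0) C (s a_lev) (s a_piv) \<and>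
        (\<forall>f<m. card (V f - C) \<le> c - 0)"
      using s card_V_le by (intro exI[of _ "{}"]) (auto simp: covered_def)
  }
qed (use c_le in auto)

lemma wp_count_level:
  assumes s: "parsed s" "s a_lev = lev" "s r_j 0 = J"
    and post: "\<And>s'. \<forall>j. j \<notin> {r_cnt, r_e} \<longrightarrow> s' j = s j \<Longrightarrow>
      s' r_cnt 0 = card {e. e < m \<and> lev e = J} \<Longrightarrow> Q s'"
  shows "wp L count_level Q s"
  unfolding count_level_def wp.simps
proof (rule wp_For[where lo = 0 and hi = m and I = "\<lambda>n s'. s' r_cnt 0 = card {e. e < n \<and> lev e = J}"])
  let ?P = "Cond (Eq (Arr a_lev (Var r_e)) (Var r_j)) (Set r_cnt (Plus (Var r_cnt) (Const 1))) Skip"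
  let ?s = "s(r_cnt := (s r_cnt)(aval (Const 0) s := aval (Const 0) s))"
  {
    fix n s'
    assume n: "n < m" "s' r_e 0 = n" "s' r_cnt 0 = card {e. e < n \<and> lev e = J}"
      and fr: "\<forall>j. j \<notin> insert r_e (writes ?P) \<longrightarrow> s' j = ?s j"
    have "{e. e < Suc n \<and> lev e = J} =
      (if lev n = J then insert n {e. e < n \<and> lev e = J} else {e. e < n \<and> lev e = J})"
      by (auto simp: less_Suc_eq)
    moreover have "s' a_lev = lev" "s' r_j 0 = J" using fr s by simp_all
    ultimately show "wp L ?P (\<lambda>s'. s' r_cnt 0 = card {e. e < Suc n \<and> lev e = J}) s'"
      using n by auto
  next
    fix s' assume "\<forall>j. j \<notin> insert r_e (writes ?P) \<longrightarrow> s' j = ?s j"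
    then have "s' a_in = s a_in" by simp
    then show "aval (Arr a_in (Const 2)) s' = m" using s by (simp add: parsed_def cell_2)
  next
    fix s'
    assume "\<forall>j. j \<notin> insert r_e (writes ?P) \<longrightarrow> s' j = ?s j"
      "s' r_cnt 0 = card {e. e < m \<and> lev e = J}"
    then show "Q s'" by (intro post) auto
  }
qed (use m_le in auto)

lemma wp_select:
  assumes s: "parsed s" "s a_lev = lev" "s r_sel 0 = 0"
    and ex: "\<exists>J. 0 < J \<and> J \<le> c \<and> k \<le> card {e. e < m \<and> lev e = J}"
    and post: "\<And>s' J. \<forall>j. j \<notin> writes (select c) \<longrightarrow> s' j = s j \<Longrightarrow> s' r_sel 0 = J \<Longrightarrow> 0 < J \<Longrightarrow>
      J \<le> c \<Longrightarrow> k \<le> card {e. e < m \<and> lev e = J} \<Longrightarrow> Q s'"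
  shows "wp L (select c) Q s"
  unfolding select_def
proof (rule wp_For[where lo = 1 and hi = "Suc c" and I = "\<lambda>n s'.
      if s' r_sel 0 = 0 then \<forall>J. 0 < J \<and> J < n \<longrightarrow> card {e. e < m \<and> lev e = J} < k
      else s' r_sel 0 < n \<and> k \<le> card {e. e < m \<and> lev e = s' r_sel 0}"])
  let ?P = "Seq count_level
          (Cond (Less (Var r_cnt) (Arr a_in (Const 1))) Skip (Set r_sel (Var r_j)))"
  let ?I = "\<lambda>n s'. if s' r_sel 0 = 0 then \<forall>J. 0 < J \<and> J < n \<longrightarrow> card {e. e < m \<and> lev e = J} < k
      else s' r_sel 0 < n \<and> k \<le> card {e. e < m \<and> lev e = s' r_sel 0}"
  {
    fix n s'
    assume n: "1 \<le> n" "s' r_j 0 = n" "?I n s'"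
      and fr: "\<forall>j. j \<notin> insert r_j (writes ?P) \<longrightarrow> s' j = s j"
    have par: "parsed s'" "s' a_lev = lev" using fr s by (simp_all add: parsed_def)
    show "wp L ?P (?I (Suc n)) s'"
      unfolding wp.simps(3)
    proof (rule wp_count_level[OF par n(2)])
      fix t assume t: "\<forall>j. j \<notin> {r_cnt, r_e} \<longrightarrow> t j = s' j"
        "t r_cnt 0 = card {e. e < m \<and> lev e = n}"
      have eq: "t r_sel 0 = s' r_sel 0" "t r_j 0 = n" "t a_in 1 = k"
        using t(1) n par by (simp_all add: parsed_def cell_1[simplified])
      show "wp L (Cond (Less (Var r_cnt) (Arr a_in (Const 1))) Skip (Set r_sel (Var r_j)))
        (?I (Suc n)) t"
        using n eq t(2) by (auto simp: less_Suc_eq split: if_splits)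
    qed
  next
    fix s'
    assume fr: "\<forall>j. j \<notin> insert r_j (writes ?P) \<longrightarrow> s' j = s j" and I: "?I (Suc c) s'"
    have "s' r_sel 0 \<noteq> 0"
    proof
      assume "s' r_sel 0 = 0"
      with I have "card {e. e < m \<and> lev e = J} < k" if "0 < J" "J \<le> c" for J
        using that by simp
      with ex show False by (meson not_le)
    qed
    with fr I show "Q s'" by (intro post[of s' "s' r_sel 0"]) auto
  }
qed (use s c_le in auto)

text \<open>Double counting: the number of covered variables is the sum of the levels. If every
  level \<open>J\<close> had fewer than \<open>k\<close> equations, this would be less than
  \<open>k\<close> times the sum from 1 to \<open>c\<close>, which is
  \<open>c * (c + 1) / 2\<close>.\<close>

lemma exists_large_level:
  assumes c: "0 < c" and cov: "covered 0 C lev piv" "\<forall>f<m. V f \<subseteq> C"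
    and n: "real (card (system_vars F)) \<ge> (real c * (real c + 1) / 2) * real k"
  shows "\<exists>J. 0 < J \<and> J \<le> c \<and> k \<le> card {e. e < m \<and> lev e = J}"
proof (rule ccontr)
  assume "\<not> ?thesis"
  then have less: "card {e. e < m \<and> lev e = J} < k" if "0 < J" "J \<le> c" for J
    using that by (meson not_le)
  have lev: "lev e \<le> c" if "e < m" for e
    using cov that by (cases "lev e = 0") (auto simp: covered_def)
  have "system_vars F \<subseteq> C"
    using cov(2) by (fastforce simp: system_vars_def in_set_conv_nth)
  then have "card (system_vars F) \<le> card C"
    using cov(1) by (intro card_mono) (auto simp: covered_def)
  also have "card C = (\<Sum>e<m. lev e)" using cov(1) by (simp add: covered_def)
  also have "\<dots> = (\<Sum>J\<le>c. \<Sum>e | e \<in> {..<m} \<and> lev e = J. lev e)"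
    using lev by (intro sum.group[symmetric]) auto
  also have "\<dots> = (\<Sum>J\<le>c. J * card {e. e < m \<and> lev e = J})"
    by (intro sum.cong refl) simp
  \<comment> \<open>Level 0 collects the equations not picked, whose number is not bounded by
    \<open>k\<close>; their factor 0 removes them.\<close>
  also have "\<dots> = (\<Sum>J=1..c. J * card {e. e < m \<and> lev e = J})"
    by (rule sum.mono_neutral_right) (auto simp: Suc_le_eq)
  also have "\<dots> < (\<Sum>J=1..c. J * k)"
    using c less by (intro sum_strict_mono) auto
  finally have "2 * card (system_vars F) < 2 * (\<Sum>J=1..c. J) * k"
    by (simp add: sum_distrib_right)
  also have "2 * (\<Sum>J=1..c. J) = c * (c + 1)"
    using double_gauss_sum_from_Suc_0[of c, where 'a = nat] by simp
  finally have "real (2 * card (system_vars F)) < real (c * (c + 1) * k)"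
    by (simp only: of_nat_less_iff)
  with n show False by (simp add: field_simps)
qed

lemma selection:
  assumes "reduced F" "block J lev piv A" "0 < J"
  shows "lin_selection c F k L lev piv A J"
proof unfold_locales
  show "b f = b g" if "f < m" "g < m" "V f = V g" for f g
  proof (rule ccontr)
    assume "b f \<noteq> b g"
    \<comment> \<open>Distinct bits differ by 1, which is the conflict that \<open>reduced\<close>
      excludes.\<close>
    then have "b f = b g + 1" using bit_cases_01[of "b f"] bit_cases_01[of "b g"] by auto
    with assms(1) that show False unfolding reduced_def by (meson nth_mem)
  qed
qed (use assms finV rhs_if_empty in \<open>auto simp: block_def\<close>)

end

section \<open>The complete algorithm and its time bound\<close>

definition max_lin :: "nat \<Rightarrow> com" where
  "max_lin c = Seq parse (Seq (greedy c) (Seq (select c) solve))"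

lemma writes_parse [simp]: "writes parse = {a_beg, r_e}"
  by (auto simp: parse_def)

lemma (in lin_instance) wp_max_lin:
  assumes "reduced F" "0 < c"
    and n: "real (card (system_vars F)) \<ge> (real c * (real c + 1) / 2) * real k"
  shows "wp L (max_lin c) (\<lambda>s'. above_average F k (decode_assignment (output_list s')) \<and>
    length (output_list s') \<le> len) (input_state (encode_instance (F, k)))"
    (is "wp L _ ?Q ?s")
proof -
  have zero: "?s j i = 0" if "j \<noteq> 0" for j i
    using that by (simp add: input_state_def)
  have "wp L parse (wp L (greedy c) (wp L (select c) (wp L solve ?Q))) ?s"
  proof (rule wp_mono[OF wp_frame[OF wp_parse]])
    show "?s a_in = cell" by (simp add: cell_def)
    fix s1 assume "parsed s1 \<and> (\<forall>j. j \<notin> writes parse \<longrightarrow> s1 j = ?s j)"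
    then have s1: "parsed s1" "\<forall>j. j \<notin> writes parse \<longrightarrow> s1 j = ?s j" by blast+
    show "wp L (greedy c) (wp L (select c) (wp L solve ?Q)) s1"
    proof (rule wp_greedy[OF s1(1)])
      show "s1 a_cov = (\<lambda>v. 0)" "s1 a_lev = (\<lambda>e. 0)" using s1(2) zero by auto
      fix s2 C
      assume s2: "\<forall>i. i \<notin> writes (greedy c) \<longrightarrow> s2 i = s1 i" "covered 0 C (s2 a_lev) (s2 a_piv)"
        "\<forall>f<m. V f \<subseteq> C"
      have par2: "parsed s2" using s1(1) s2(1) by (simp add: parsed_def)
      show "wp L (select c) (wp L solve ?Q) s2"
      proof (rule wp_select[OF par2 refl])
        show "s2 r_sel 0 = 0" using s1(2) s2(1) zero by simp
        show "\<exists>J. 0 < J \<and> J \<le> c \<and> k \<le> card {e. e < m \<and> s2 a_lev e = J}"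
          using assms(2) s2(2,3) n by (rule exists_large_level)
        fix s3 J
        assume s3: "\<forall>j. j \<notin> writes (select c) \<longrightarrow> s3 j = s2 j" "s3 r_sel 0 = J" "0 < J" "J \<le> c"
          "k \<le> card {e. e < m \<and> s2 a_lev e = J}"
        from s2(2) s3 obtain A where "block J (s2 a_lev) (s2 a_piv) A" by (auto simp: covered_def)
        then interpret lin_selection c F k L "s2 a_lev" "s2 a_piv" A J
          using assms(1) s3(3) by (intro selection)
        have eq: "s3 j = ?s j" if "j \<in> {a_asg, a_last, a_out}" for j
          using that s1(2) s2(1) s3(1) by auto
        show "wp L solve ?Q s3"
        proof (rule wp_solve[OF _ _ _ _ s3(5)])
          show "ready s3" using par2 s3 by (simp add: ready_def parsed_def)
          show "s3 a_asg = bits (\<lambda>_. 0)" "\<forall>f<m. s3 a_last f = 0" "s3 a_out 0 = 0"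
            using eq zero by (auto simp: bits_def)
        qed
      qed
    qed
  qed
  then show ?thesis by (simp add: max_lin_def)
qed

lemma length_le_input_size: "length xs \<le> input_size xs"
  by (induction xs) (simp_all add: input_size_def)

theorem theorem3:
  fixes c :: nat
  assumes "c \<ge> 2"
  shows "(\<forall>F k. max_lin2_system c F \<and> reduced F \<and>
            real (card (system_vars F)) \<ge> (real c * (real c + 1) / 2) * real k
            \<longrightarrow> yes_instance F k) \<and>
         poly_time_search encode_instance
           {(F, k). max_lin2_system c F \<and> reduced F \<and>
              real (card (system_vars F)) \<ge> (real c * (real c + 1) / 2) * real k}
           (\<lambda>(F, k) ys. above_average F k (decode_assignment ys))"
proof -
  obtain q where q: "\<And>L. cost L (max_lin c) = poly q L"
    using cost_poly by blast
  \<comment> \<open>With \<open>L\<close> chosen as \<open>c\<close> plus the input size, the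
    composition of \<open>q\<close> with \<open>[:c, 1:]\<close> bounds the time, and the added
    \<open>[:0, 1:]\<close> pays for the length of the output.\<close>
  have run: "\<exists>t s. runs (max_lin c) (input_state (encode_instance (F, k))) t s \<and>
      t + length (output_list s) \<le> poly (pcompose q [:c, 1:] + [:0, 1:]) (input_size (encode_instance (F, k))) \<and>
      above_average F k (decode_assignment (output_list s))"
    if "max_lin2_system c F" "reduced F"
      "real (card (system_vars F)) \<ge> (real c * (real c + 1) / 2) * real k" for F k
  proof -
    let ?n = "input_size (encode_instance (F, k))"
    interpret lin_instance c F k "c + ?n"
      using that(1) length_le_input_size[of "encode_instance (F, k)"] by unfold_locales auto
    have "0 < c" using assms by simp
    from wp_sound[OF wp_max_lin[OF that(2) this that(3)]] obtain t s where
      "runs (max_lin c) (input_state (encode_instance (F, k))) t s" "t \<le> cost (c + ?n) (max_lin c)"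
      "above_average F k (decode_assignment (output_list s))" "length (output_list s) \<le> len"
      by blast
    moreover from this(4) have "length (output_list s) \<le> ?n"
      using length_le_input_size[of "encode_instance (F, k)"] by linarith
    ultimately show ?thesis
      by (intro exI[of _ t] exI[of _ s]) (simp add: q poly_pcompose)
  qed
  then have "poly_time_search encode_instance
           {(F, k). max_lin2_system c F \<and> reduced F \<and>
              real (card (system_vars F)) \<ge> (real c * (real c + 1) / 2) * real k}
           (\<lambda>(F, k) ys. above_average F k (decode_assignment ys))"
    unfolding poly_time_search_def
    by (intro exI[of _ "max_lin c"] exI[of _ "pcompose q [:c, 1:] + [:0, 1:]"]) blast
  moreover have "yes_instance F k"
    if "max_lin2_system c F" "reduced F"
      "real (card (system_vars F)) \<ge> (real c * (real c + 1) / 2) * real k" for F k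
    using run[OF that] unfolding yes_instance_def by blast
  ultimately show ?thesis by blast
qed

end
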